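(* Let real initial data $a_n(0)>0$, $b_n(0)$, $n\in\mathbb{Z}$, be given such that $$a_n(0)\to 0,\quad b_n(0)\to 0\quad (n\to+\infty),\qquad \sum_{n<0}|n|\bigl\{|a_n(0)-1|+|b_n(0)|\bigr\}<\infty.$$ Then the Cauchy problem on $t\in[0,\infty)$ for the Toda lattice $$\dot a_n=\frac{a_n}{2}\,(b_{n+1}-b_n),\qquad \dot b_n=a_n^2-a_{n-1}^2,\qquad a_n=a_n(t)>0,\ b_n=b_n(t)\in\mathbb{R},\ n\in\mathbb{Z},$$ with these initial data has a unique solution in the class of all $(a_n(t),b_n(t))_{n\in\mathbb{Z}}$ such that for every $T>0$ $$\|a_n(t)\|_{C[0,T]}\to 0,\quad \|b_n(t)\|_{C[0,T]}\to 0\quad (n\to+\infty),\qquad \|Q(t)\|_{C[0,T]}<\infty,$$ where $Q(t)=\sum_{n<0}|n|\bigl(|a_n(t)-1|+|b_n(t)|\bigr)$.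
   Context: The dot denotes $d/dt$. For a function $g$ on $[0,T]$, $\|g\|_{C[0,T]}=\sup_{0\le t\le T}|g(t)|$. *)

theory Defs
  imports "HOL-Analysis.Analysis"
begin

text \<open>Sequences of functions are written \<open>a n t\<close> for \<open>a\<^sub>n(t)\<close>; only the values at \<open>t \<ge> 0\<close> matter.
  The derivative at \<open>t = 0\<close> is one-sided.\<close>

definition toda_solution :: "(int \<Rightarrow> real \<Rightarrow> real) \<Rightarrow> (int \<Rightarrow> real \<Rightarrow> real) \<Rightarrow> bool" where
  "toda_solution a b \<longleftrightarrow>
     (\<forall>n. \<forall>t\<ge>0.
        a n t > 0 \<and>
        (a n has_real_derivative a n t / 2 * (b (n + 1) t - b n t)) (at t within {0..}) \<and>
        (b n has_real_derivative (a n t)\<^sup>2 - (a (n - 1) t)\<^sup>2) (at t within {0..}))"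

text \<open>The supremum norm on \<open>[0,T]\<close> takes values in \<^typ>\<open>ennreal\<close>, so that it is \<open>\<infinity>\<close> (and not an
  unspecified real) for unbounded functions. The argument is the absolute value of the function;
  it is itself \<^typ>\<open>ennreal\<close>-valued to allow for divergent series.\<close>

definition C_norm :: "real \<Rightarrow> (real \<Rightarrow> ennreal) \<Rightarrow> ennreal" where
  "C_norm T g = (SUP t\<in>{0..T}. g t)"

definition toda_Q :: "(int \<Rightarrow> real \<Rightarrow> real) \<Rightarrow> (int \<Rightarrow> real \<Rightarrow> real) \<Rightarrow> real \<Rightarrow> ennreal" where
  "toda_Q a b t = (\<Sum>\<^sub>\<infinity>n\<in>{..<0}. ennreal (real_of_int \<bar>n\<bar> * (\<bar>a n t - 1\<bar> + \<bar>b n t\<bar>)))"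

definition toda_class :: "(int \<Rightarrow> real \<Rightarrow> real) \<Rightarrow> (int \<Rightarrow> real \<Rightarrow> real) \<Rightarrow> bool" where
  "toda_class a b \<longleftrightarrow>
     (\<forall>T>0.
        ((\<lambda>n. C_norm T (\<lambda>t. ennreal \<bar>a n t\<bar>)) \<longlongrightarrow> 0) at_top \<and>
        ((\<lambda>n. C_norm T (\<lambda>t. ennreal \<bar>b n t\<bar>)) \<longlongrightarrow> 0) at_top \<and>
        C_norm T (toda_Q a b) < \<infinity>)"

definition toda_cauchy_solution ::
  "(int \<Rightarrow> real) \<Rightarrow> (int \<Rightarrow> real) \<Rightarrow> (int \<Rightarrow> real \<Rightarrow> real) \<Rightarrow> (int \<Rightarrow> real \<Rightarrow> real) \<Rightarrow> bool" where
  "toda_cauchy_solution a0 b0 a b \<longleftrightarrow>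
     toda_solution a b \<and> toda_class a b \<and> (\<forall>n. a n 0 = a0 n \<and> b n 0 = b0 n)"

end

theory Submission
  imports Defs "HOL-Probability.Discrete_Topology"
begin

text \<open>
The right-hand side of the Toda lattice is locally Lipschitz on bounded sequences, so the point of
global existence is an a priori bound in \<open>\<ell>\<^sup>\<infinity>(\<int>)\<close>. It comes from the Lax pair. Let \<open>L(t)\<close> be the Jacobi
operator with off-diagonal entries \<open>a\<^sub>n(t)\<close> and diagonal entries \<open>b\<^sub>n(t)\<close>, acting on \<open>\<ell>\<^sup>2(\<int>)\<close>. The
equations say that the derivative of \<open>L\<close> is \<open>[A, L]\<close> with a skew-symmetric \<open>A\<close>, hence \<open>L(t)\<close> is
orthogonally conjugate to \<open>L(0)\<close> and has the same operator norm, which dominates all entries. This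
conservation law (\<open>jacobi_norm_le_conserved\<close>) is proved by discretizing time:
\<open>(1 + h A) L (1 - h A)\<close> differs from \<open>L(t + h)\<close> by \<open>O(h\<^sup>2)\<close>, and \<open>1 \<plusminus> h A\<close> is orthogonal up to
\<open>O(h\<^sup>2)\<close>. To obtain a solution in the first place, the entries are clipped at a level above the
a priori bound. The clipped system is globally Lipschitz and has a solution for all times by
\<open>picard_lipschitz_halfline\<close>; a bootstrap argument with the conservation law shows that the clipping
is never active (\<open>toda_bounded_solution_exists\<close>).

Decay, summability and uniqueness follow from one Gronwall inequality for infinite families with
nearest-neighbour coupling, \<open>abs_le_exp_of_neighbour_growth\<close>: among bounded families, a profile \<open>Z\<^sub>n\<close> of
the initial data with \<open>Z\<^sub>n\<^sub>\<plusminus>\<^sub>1 \<le> q Z\<^sub>n\<close> is preserved up to a factor independent of \<open>n\<close>.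
Applied to \<open>a\<^sub>n\<close> alone it yields the decay of \<open>a\<^sub>n\<close>, and by integration that of \<open>b\<^sub>n\<close>, for \<open>n \<rightarrow> +\<infinity>\<close>.
Applied to \<open>a\<^sub>n - 1\<close> and \<open>b\<^sub>n\<close>, with \<open>Z\<close> a slowly
varying majorant of \<open>\<bar>a\<^sub>n(0) - 1\<bar> + \<bar>b\<^sub>n(0)\<bar>\<close> that is still summable with weight \<open>\<bar>n\<bar>\<close> on the left
(\<open>slowly_varying_majorant\<close>), it yields the bound on \<open>Q\<close>. Applied to the difference of two solutions,
with \<open>Z = 0\<close>, it yields uniqueness, because solutions in the class are bounded on compact time
intervals (\<open>toda_cauchy_solution_bounded\<close>). Positivity of \<open>a\<^sub>n\<close> holds as \<open>a\<^sub>n\<close> satisfies a linear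
homogeneous scalar equation.
\<close>

section \<open>Mean value inequalities and the global Picard theorem\<close>

text \<open>The mean value inequality with one-sided derivatives: the derivatives are taken within a set
\<^term>\<open>S\<close> that may have the endpoint \<^term>\<open>x\<close> on its boundary, as \<^term>\<open>{0::real..}\<close> does at \<^term>\<open>0::real\<close>.\<close>
lemma norm_diff_le_of_derivative_bound:
  fixes f :: "real \<Rightarrow> 'a::real_normed_vector"
  assumes "x \<le> y" "{x..y} \<subseteq> S"
    and f: "\<And>s. s \<in> {x..y} \<Longrightarrow> (f has_vector_derivative f' s) (at s within S)"
    and g: "\<And>s. s \<in> {x..y} \<Longrightarrow> (g has_real_derivative g' s) (at s within S)"
    and le: "\<And>s. s \<in> {x..y} \<Longrightarrow> norm (f' s) \<le> g' s"
  shows "norm (f y - f x) \<le> g y - g x"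
proof (cases "x = y")
  case False
  with \<open>x \<le> y\<close> have "x < y" by simp
  have f1: "(f has_vector_derivative f' s) (at s within {x..y})" if "s \<in> {x..y}" for s
    using f[OF that] assms(2) has_vector_derivative_within_subset by blast
  have g1: "(g has_vector_derivative g' s) (at s within {x..y})" if "s \<in> {x..y}" for s
    using g[OF that] assms(2) has_vector_derivative_within_subset
    unfolding has_real_derivative_iff_has_vector_derivative by blast
  have cf: "continuous_on {x..y} f"
    by (rule continuous_on_vector_derivative) (rule f1)
  have cg: "continuous_on {x..y} g"
    by (rule continuous_on_vector_derivative) (rule g1)
  have at: "at s within {x..y} = at s" if "x < s" "s < y" for s
    by (rule at_within_Icc_at[OF that])
  have f2: "(f has_vector_derivative f' s) (at s)" if "x < s" "s < y" for s
    using f1[of s] that unfolding at[OF that] by simp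
  have g2: "(g has_vector_derivative g' s) (at s)" if "x < s" "s < y" for s
    using g1[of s] that unfolding at[OF that] by simp
  show ?thesis
    by (rule differentiable_bound_general[OF \<open>x < y\<close> cf cg f2 g2]) (use le in simp_all)
qed auto

lemma abs_le_of_derivative_bound:
  fixes f :: "real \<Rightarrow> real"
  assumes "x \<le> y" "{x..y} \<subseteq> S"
    and f: "\<And>s. s \<in> {x..y} \<Longrightarrow> (f has_real_derivative f' s) (at s within S)"
    and g: "\<And>s. s \<in> {x..y} \<Longrightarrow> (g has_real_derivative g' s) (at s within S)"
    and le: "\<And>s. s \<in> {x..y} \<Longrightarrow> \<bar>f' s\<bar> \<le> g' s"
    and "\<bar>f x\<bar> \<le> g x"
  shows "\<bar>f y\<bar> \<le> g y"
proof -
  have "norm (f y - f x) \<le> g y - g x"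
    by (rule norm_diff_le_of_derivative_bound[OF assms(1,2) _ g])
      (use f le in \<open>auto simp: has_real_derivative_iff_has_vector_derivative\<close>)
  with \<open>\<bar>f x\<bar> \<le> g x\<close> show ?thesis unfolding real_norm_def by linarith
qed

lemma integral_has_vector_derivative_halfline:
  fixes h :: "real \<Rightarrow> 'a::banach"
  assumes "continuous_on {0..} h" "t \<ge> 0"
  shows "((\<lambda>t. integral {0..t} h) has_vector_derivative h t) (at t within {0..})"
proof -
  have "((\<lambda>t. integral {0..t} h) has_vector_derivative h t) (at t within {0..t+1})"
    by (rule integral_has_vector_derivative) (use assms in \<open>auto intro: continuous_on_subset\<close>)
  moreover have "at t within {0..t+1} = at t within {0..}"
    by (rule at_within_nhd[of _ "{t-1<..<t+1}"]) auto
  ultimately show ?thesis by simp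
qed

text \<open>The gain \<open>1 / l\<close> is what makes the Picard operator a contraction in the norm with weight
\<open>exp (- l t)\<close>.\<close>
lemma norm_integral_le_of_exp_bound:
  fixes h :: "real \<Rightarrow> 'a::banach"
  assumes h: "continuous_on {0..} h" and bd: "\<And>s. s \<ge> 0 \<Longrightarrow> norm (h s) \<le> c * exp (l * s)"
    and "l > 0" "t \<ge> 0"
  shows "norm (integral {0..t} h) \<le> c / l * exp (l * t)"
proof -
  have "norm (integral {0..t} h - integral {0..0} h) \<le> c / l * exp (l * t) - c / l * exp (l * 0)"
    by (rule norm_diff_le_of_derivative_bound[where S="{0..}" and f'=h and g'="\<lambda>s. c * exp (l * s)"])
      (use assms in \<open>auto intro!: integral_has_vector_derivative_halfline derivative_eq_intros\<close>)
  moreover have "c \<ge> 0" using bd[of 0] norm_ge_zero[of "h 0"] by (simp del: norm_ge_zero)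
  then have "c / l \<ge> 0" using \<open>l > 0\<close> by simp
  ultimately show ?thesis by simp
qed

text \<open>The substitution \<open>u t = exp (l t) *\<^sub>R v t\<close> turns the integral equation for \<open>u\<close> into a fixed
point equation for a bounded continuous \<open>v\<close>. With \<open>l\<close> at least twice the Lipschitz constant the
fixed point map contracts by \<open>1/2\<close> on the whole half-line at once, so no continuation of local
solutions is necessary.\<close>
theorem picard_lipschitz_halfline:
  fixes F :: "'a::banach \<Rightarrow> 'a"
  assumes lip: "\<And>x y. norm (F x - F y) \<le> K * norm (x - y)"
  obtains u where "u 0 = x0"
    and "\<And>t. t \<ge> 0 \<Longrightarrow> (u has_vector_derivative F (u t)) (at t within {0..})"
proof -
  define l where "l = 2 * (\<bar>K\<bar> + 1)"
  have l: "l > 0" by (simp add: l_def)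
  have lip': "norm (F x - F y) \<le> (l/2) * norm (x - y)" for x y
    by (rule order_trans[OF lip mult_right_mono]) (auto simp: l_def)
  have contF: "continuous_on UNIV F"
  proof (rule lipschitz_on_continuous_on)
    show "(l/2)-lipschitz_on UNIV F" using lip' l by (auto simp: lipschitz_on_def dist_norm)
  qed
  define h where "h v s = F (exp (l * s) *\<^sub>R apply_bcontfun v s)" for v :: "real \<Rightarrow>\<^sub>C 'a" and s
  have conth: "continuous_on S (h v)" for v S unfolding h_def
    by (rule continuous_on_compose2[OF contF]) (auto intro!: continuous_intros)
  \<comment> \<open>Bounded continuous functions are defined on all of the real line: negative times are clamped to \<open>0\<close>.\<close>
  define I where "I v t = integral {0..max 0 t} (h v)" for v t
  have contI: "continuous_on UNIV (I v)" for v
  proof -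
    have "continuous_on {0..} (\<lambda>t. integral {0..t} (h v))"
      by (rule continuous_on_vector_derivative) (rule integral_has_vector_derivative_halfline[OF conth], simp)
    then show ?thesis unfolding I_def
      by (rule continuous_on_compose2) (auto intro!: continuous_intros)
  qed
  define \<Phi>0 where "\<Phi>0 v t = exp (- l * max 0 t) *\<^sub>R (x0 + I v t)" for v t
  have bcont: "\<Phi>0 v \<in> bcontfun" for v
  proof (rule bcontfun_normI)
    show "continuous_on UNIV (\<Phi>0 v)" unfolding \<Phi>0_def by (intro continuous_intros contI)
    let ?c = "norm (F 0) + (l/2) * norm v"
    fix t :: real
    define t' where "t' = max 0 t"
    have t': "t' \<ge> 0" by (simp add: t'_def)
    have "norm (h v s) \<le> ?c * exp (l * s)" if "s \<ge> 0" for s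
    proof -
      have "norm (h v s) \<le> norm (F 0) + norm (h v s - F 0)" by (rule norm_triangle_sub)
      also have "norm (h v s - F 0) \<le> (l/2) * (exp (l * s) * norm (apply_bcontfun v s))"
        using lip'[of "exp (l * s) *\<^sub>R apply_bcontfun v s" 0] by (simp add: h_def)
      also have "\<dots> \<le> (l/2) * (exp (l * s) * norm v)"
        using l by (intro mult_left_mono norm_bounded) auto
      also have "norm (F 0) \<le> norm (F 0) * exp (l * s)"
        using mult_left_mono[of 1 "exp (l * s)" "norm (F 0)"] l that by simp
      finally show ?thesis by (simp add: algebra_simps)
    qed
    then have "norm (I v t) \<le> ?c / l * exp (l * t')"
      unfolding I_def t'_def by (intro norm_integral_le_of_exp_bound[OF conth _ l]) auto
    then have "norm (x0 + I v t) \<le> norm x0 + ?c / l * exp (l * t')"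
      using norm_triangle_ineq[of x0 "I v t"] by linarith
    then have "norm (\<Phi>0 v t) \<le> exp (- l * t') * (norm x0 + ?c / l * exp (l * t'))"
      unfolding \<Phi>0_def t'_def[symmetric] by simp
    also have "\<dots> = exp (- l * t') * norm x0 + ?c / l * (exp (- l * t') * exp (l * t'))"
      by (simp add: algebra_simps)
    also have "\<dots> = exp (- l * t') * norm x0 + ?c / l" by (simp add: mult_exp_exp)
    also have "\<dots> \<le> norm x0 + ?c / l" using l t' by (simp add: mult_left_le_one_le)
    finally show "norm (\<Phi>0 v t) \<le> norm x0 + ?c / l" .
  qed
  define \<Phi> where "\<Phi> v = Bcontfun (\<Phi>0 v)" for v
  have app: "apply_bcontfun (\<Phi> v) t = \<Phi>0 v t" for v t
    using bcont by (simp add: \<Phi>_def Bcontfun_inverse)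
  have contr: "norm (\<Phi> v - \<Phi> w) \<le> 1/2 * norm (v - w)" for v w
  proof (rule norm_bound)
    fix t :: real
    define t' where "t' = max 0 t"
    have t': "t' \<ge> 0" by (simp add: t'_def)
    have "I v t - I w t = integral {0..t'} (\<lambda>s. h v s - h w s)"
      unfolding I_def t'_def by (intro integral_diff[symmetric] integrable_continuous_real conth)
    also have "norm \<dots> \<le> (l/2 * norm (v - w)) / l * exp (l * t')"
    proof (rule norm_integral_le_of_exp_bound[OF _ _ l t'])
      show "continuous_on {0..} (\<lambda>s. h v s - h w s)" by (intro continuous_intros conth)
      fix s :: real
      have "norm (h v s - h w s) \<le> l/2 * norm (exp (l * s) *\<^sub>R apply_bcontfun v s - exp (l * s) *\<^sub>R apply_bcontfun w s)"
        unfolding h_def by (rule lip')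
      also have "\<dots> = l/2 * (exp (l * s) * norm (apply_bcontfun (v - w) s))"
        by (simp flip: scaleR_diff_right)
      also have "\<dots> \<le> l/2 * (exp (l * s) * norm (v - w))"
        using l by (intro mult_left_mono norm_bounded) auto
      finally show "norm (h v s - h w s) \<le> l/2 * norm (v - w) * exp (l * s)" by (simp add: ac_simps)
    qed
    finally have *: "norm (I v t - I w t) \<le> 1/2 * norm (v - w) * exp (l * t')" using l by simp
    have "norm (apply_bcontfun (\<Phi> v - \<Phi> w) t) = exp (- l * t') * norm (I v t - I w t)"
      by (simp add: app \<Phi>0_def t'_def flip: scaleR_diff_right)
    also have "\<dots> \<le> exp (- l * t') * (1/2 * norm (v - w) * exp (l * t'))"
      using * by (intro mult_left_mono) auto
    also have "\<dots> = 1/2 * norm (v - w) * (exp (- l * t') * exp (l * t'))" by simp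
    also have "\<dots> = 1/2 * norm (v - w)" by (simp add: mult_exp_exp)
    finally show "norm (apply_bcontfun (\<Phi> v - \<Phi> w) t) \<le> 1/2 * norm (v - w)" .
  qed
  obtain v where v: "\<Phi> v = v"
    using banach_fix_type[of "1/2" \<Phi>] contr by (auto simp: dist_norm)
  define u where "u t = x0 + I v t" for t
  have uv: "u t = exp (l * t) *\<^sub>R apply_bcontfun v t" if "t \<ge> 0" for t
    using app[of v t] that by (simp add: v \<Phi>0_def u_def mult_exp_exp)
  show thesis
  proof
    show "u 0 = x0" by (simp add: u_def I_def)
    fix t :: real assume t: "t \<ge> 0"
    have "((\<lambda>t. x0 + integral {0..t} (h v)) has_vector_derivative 0 + h v t) (at t within {0..})"
      by (intro derivative_intros integral_has_vector_derivative_halfline conth t)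
    then have "((\<lambda>t. x0 + integral {0..t} (h v)) has_vector_derivative F (u t)) (at t within {0..})"
      using uv[OF t] by (simp add: h_def)
    then show "(u has_vector_derivative F (u t)) (at t within {0..})"
      by (rule has_vector_derivative_transform[rotated 2]) (use t in \<open>auto simp: u_def I_def\<close>)
  qed
qed

section \<open>A Gronwall inequality for coupled families\<close>

text \<open>A Gronwall inequality for infinitely many functions \<open>f i\<close>, in which the growth of \<open>f i\<close> is
controlled by its neighbours \<open>N i\<close> only. It keeps track of the size of
each \<open>f i\<close> separately: a profile \<open>Z\<close> that varies by at most the factor \<open>q\<close> between neighbours is
propagated, whatever its behaviour at infinity. Inserting the a priori bound \<open>M\<close> into the
differential inequality \<open>k\<close> times leaves the error \<open>M (K t)^k / k!\<close>, which tends to \<open>0\<close>. The choice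
\<open>Z = 0\<close> gives uniqueness statements.\<close>
lemma abs_le_exp_of_neighbour_growth:
  fixes f f' :: "'i \<Rightarrow> real \<Rightarrow> real" and N :: "'i \<Rightarrow> 'i set"
  assumes der: "\<And>i t. t \<in> {0..T} \<Longrightarrow> (f i has_real_derivative f' i t) (at t within {0..})"
    and growth: "\<And>i t B. t \<in> {0..T} \<Longrightarrow> (\<And>j. j \<in> N i \<Longrightarrow> \<bar>f j t\<bar> \<le> B) \<Longrightarrow> \<bar>f' i t\<bar> \<le> K * B"
    and slow: "\<And>i j. j \<in> N i \<Longrightarrow> Z j \<le> q * Z i"
    and init: "\<And>i. \<bar>f i 0\<bar> \<le> Z i"
    and bdd: "\<And>i t. t \<in> {0..T} \<Longrightarrow> \<bar>f i t\<bar> \<le> M"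
    and t: "t \<in> {0..T}" and "M \<ge> 0"
  shows "\<bar>f i t\<bar> \<le> Z i * exp (K * q * t)"
proof -
  have Z: "Z i \<ge> 0" for i using init[of i] by linarith
  have main: "\<bar>f i t\<bar> \<le> Z i * exp (K * q * t) + M * ((K * t) ^ k / fact k)" if "t \<in> {0..T}" for k i t
    using that
  proof (induction k arbitrary: i t)
    case 0
    then show ?case using bdd[of t i] Z[of i] by (simp add: add_increasing)
  next
    case (Suc k)
    show ?case
    proof (rule abs_le_of_derivative_bound[where x=0 and y=t and S="{0..}" and f="f i" and f'="f' i" and
          g="\<lambda>t. Z i * exp (K * q * t) + M * ((K * t) ^ Suc k / fact (Suc k))" and
          g'="\<lambda>s. K * (q * Z i * exp (K * q * s) + M * ((K * s) ^ k / fact k))"])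
      fix s assume "s \<in> {0..t}"
      then have s: "s \<in> {0..T}" using Suc.prems by auto
      show "(f i has_real_derivative f' i s) (at s within {0..})" by (rule der[OF s])
      let ?e = "M * ((K * s) ^ k / fact k)"
      have "\<bar>f j s\<bar> \<le> q * Z i * exp (K * q * s) + ?e" if "j \<in> N i" for j
        using Suc.IH[OF s, of j] mult_right_mono[OF slow[OF that] exp_ge_zero, of "K * q * s"] by linarith
      from growth[OF s this]
      show "\<bar>f' i s\<bar> \<le> K * (q * Z i * exp (K * q * s) + ?e)" by simp
      have "((\<lambda>t. (K * t) ^ Suc k / fact (Suc k)) has_real_derivative K * ((K * s) ^ k / fact k)) (at s within {0..})"
        by (rule DERIV_cong[OF DERIV_cdivide[OF DERIV_power_Suc[OF DERIV_cmult_Id]]]) (simp add: divide_simps)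
      note d1 = DERIV_cmult[OF this, of M]
      have d2: "((\<lambda>t. Z i * exp (K * q * t)) has_real_derivative K * (q * Z i * exp (K * q * s))) (at s within {0..})"
        by (auto intro!: derivative_eq_intros)
      show "((\<lambda>t. Z i * exp (K * q * t) + M * ((K * t) ^ Suc k / fact (Suc k)))
        has_real_derivative K * (q * Z i * exp (K * q * s) + ?e)) (at s within {0..})"
        by (rule DERIV_cong[OF DERIV_add[OF d2 d1]]) (simp add: distrib_left)
    qed (use Suc.prems init in auto)
  qed
  have "(\<lambda>k. Z i * exp (K * q * t) + M * ((K * t) ^ k / fact k)) \<longlonglongrightarrow> Z i * exp (K * q * t) + M * 0"
    using summable_LIMSEQ_zero[OF summable_exp[of "K * t"]]
    by (intro tendsto_intros) (simp add: field_simps)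
  then show ?thesis
    using LIMSEQ_le_const main[OF t] by (metis (no_types, lifting) add.right_neutral mult_zero_right)
qed

section \<open>Finitely supported sequences and Jacobi operators\<close>

text \<open>Operators on \<open>\<ell>\<^sup>2(\<int>)\<close> are only ever applied to finitely supported sequences here. This dense subspace
is invariant under banded matrices, and on it all sums are finite.\<close>
definition fin_supp :: "(int \<Rightarrow> real) \<Rightarrow> bool" where
  "fin_supp v \<longleftrightarrow> finite {n. v n \<noteq> 0}"

definition l2norm :: "(int \<Rightarrow> real) \<Rightarrow> real" where
  "l2norm v = L2_set v {n. v n \<noteq> 0}"

lemma l2norm_eq_L2_set:
  assumes "finite A" "\<And>n. n \<notin> A \<Longrightarrow> v n = 0"
  shows "l2norm v = L2_set v A"
proof -
  have "(\<Sum>n | v n \<noteq> 0. (v n)\<^sup>2) = (\<Sum>n\<in>A. (v n)\<^sup>2)"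
    using assms by (intro sum.mono_neutral_left) auto
  then show ?thesis by (simp add: l2norm_def L2_set_def)
qed

lemma l2norm_nonneg: "l2norm v \<ge> 0"
  by (simp add: l2norm_def)

lemma l2norm_power2:
  assumes "finite A" "\<And>n. n \<notin> A \<Longrightarrow> v n = 0"
  shows "(l2norm v)\<^sup>2 = (\<Sum>n\<in>A. (v n)\<^sup>2)"
  by (simp add: l2norm_eq_L2_set[OF assms] L2_set_def sum_nonneg)

lemma fin_supp_add: "fin_supp u \<Longrightarrow> fin_supp v \<Longrightarrow> fin_supp (\<lambda>n. u n + v n)"
  unfolding fin_supp_def by (rule finite_subset[of _ "{n. u n \<noteq> 0} \<union> {n. v n \<noteq> 0}"]) auto

lemma fin_supp_mult: "fin_supp v \<Longrightarrow> fin_supp (\<lambda>n. c n * v n)"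
  unfolding fin_supp_def by (rule finite_subset[of _ "{n. v n \<noteq> 0}"]) auto

lemma fin_supp_shift: assumes "fin_supp v" shows "fin_supp (\<lambda>n. v (n + k))"
proof -
  have "{n. v (n + k) \<noteq> 0} \<subseteq> (\<lambda>n. n - k) ` {n. v n \<noteq> 0}"
  proof
    fix n assume "n \<in> {n. v (n + k) \<noteq> 0}"
    then have "n = (n + k) - k" "n + k \<in> {n. v n \<noteq> 0}" by auto
    then show "n \<in> (\<lambda>n. n - k) ` {n. v n \<noteq> 0}" by blast
  qed
  with assms show ?thesis unfolding fin_supp_def by (meson finite_imageI finite_subset)
qed

lemma l2norm_triangle:
  assumes "fin_supp u" "fin_supp v"
  shows "l2norm (\<lambda>n. u n + v n) \<le> l2norm u + l2norm v"
proof -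
  let ?A = "{n. u n \<noteq> 0} \<union> {n. v n \<noteq> 0}"
  have "finite ?A" using assms by (simp add: fin_supp_def)
  then have "l2norm (\<lambda>n. u n + v n) = L2_set (\<lambda>n. u n + v n) ?A"
    "l2norm u = L2_set u ?A" "l2norm v = L2_set v ?A"
    by (intro l2norm_eq_L2_set; auto)+
  then show ?thesis by (simp add: L2_set_triangle_ineq)
qed

lemma l2norm_mult_le:
  assumes v: "fin_supp v" and c: "\<And>n. \<bar>c n\<bar> \<le> C"
  shows "l2norm (\<lambda>n. c n * v n) \<le> C * l2norm v"
proof -
  let ?A = "{n. v n \<noteq> 0}"
  have C: "C \<ge> 0" using c[of 0] by linarith
  have fin: "finite ?A" using v by (simp add: fin_supp_def)
  have "(l2norm (\<lambda>n. c n * v n))\<^sup>2 = (\<Sum>n\<in>?A. (c n * v n)\<^sup>2)"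
    by (rule l2norm_power2[OF fin]) auto
  also have "\<dots> \<le> (\<Sum>n\<in>?A. C\<^sup>2 * (v n)\<^sup>2)"
    by (intro sum_mono) (auto simp: power_mult_distrib intro!: mult_right_mono c abs_le_square_iff[THEN iffD1, of _ C, simplified abs_of_nonneg[OF C]])
  also have "\<dots> = (C * l2norm v)\<^sup>2"
    using l2norm_power2[OF fin, of v] by (simp add: power_mult_distrib sum_distrib_left)
  finally show ?thesis
    using C l2norm_nonneg by (auto intro!: power2_le_imp_le)
qed

lemma sum_shift_fin_supp:
  fixes k :: int
  assumes "finite A" "\<And>n. n \<notin> A \<Longrightarrow> f n = 0" "\<And>n. n \<notin> A \<Longrightarrow> f (n + k) = (0::real)"
  shows "(\<Sum>n\<in>A. f (n + k)) = (\<Sum>n\<in>A. f n)"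
proof -
  have "(\<Sum>n\<in>A. f (n + k)) = (\<Sum>n | f (n + k) \<noteq> 0. f (n + k))"
    using assms by (intro sum.mono_neutral_right) auto
  also have "\<dots> = (\<Sum>n | f n \<noteq> 0. f n)"
    by (rule sum.reindex_bij_witness[of _ "\<lambda>n. n - k" "\<lambda>n. n + k"]) auto
  also have "\<dots> = (\<Sum>n\<in>A. f n)"
    using assms by (intro sum.mono_neutral_left) auto
  finally show ?thesis .
qed

lemma l2norm_shift:
  assumes "fin_supp v"
  shows "l2norm (\<lambda>n. v (n + k)) = l2norm v"
proof -
  let ?A = "{n. v n \<noteq> 0} \<union> {n. v (n + k) \<noteq> 0}"
  have fin: "finite ?A" using assms fin_supp_shift[of v k] by (simp add: fin_supp_def)
  have "(l2norm (\<lambda>n. v (n + k)))\<^sup>2 = (\<Sum>n\<in>?A. (v (n + k))\<^sup>2)"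
    by (rule l2norm_power2[OF fin]) auto
  also have "\<dots> = (\<Sum>n\<in>?A. (v n)\<^sup>2)"
    by (rule sum_shift_fin_supp[OF fin, of "\<lambda>n. (v n)\<^sup>2"]) auto
  also have "\<dots> = (l2norm v)\<^sup>2" by (rule l2norm_power2[OF fin, symmetric]) auto
  finally show ?thesis using l2norm_nonneg by (simp add: power2_eq_iff_nonneg)
qed

text \<open>The Jacobi operator \<open>L\<close> and the skew-symmetric partner \<open>A\<close> of its Lax pair.\<close>
definition jacobi :: "(int \<Rightarrow> real) \<Rightarrow> (int \<Rightarrow> real) \<Rightarrow> (int \<Rightarrow> real) \<Rightarrow> int \<Rightarrow> real" where
  "jacobi a b v n = a (n - 1) * v (n - 1) + b n * v n + a n * v (n + 1)"

definition skew :: "(int \<Rightarrow> real) \<Rightarrow> (int \<Rightarrow> real) \<Rightarrow> int \<Rightarrow> real" where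
  "skew a v n = (a n * v (n + 1) - a (n - 1) * v (n - 1)) / 2"

lemma fin_supp_jacobi: "fin_supp v \<Longrightarrow> fin_supp (jacobi a b v)"
  using fin_supp_add[OF fin_supp_add[OF
    fin_supp_mult[OF fin_supp_shift[of v "-1"], of "\<lambda>n. a (n - 1)"] fin_supp_mult[of v b]]
    fin_supp_mult[OF fin_supp_shift[of v 1], of a]]
  by (simp add: jacobi_def[abs_def])

lemma l2norm_jacobi_le:
  assumes v: "fin_supp v" and a: "\<And>n. \<bar>a n\<bar> \<le> R" and b: "\<And>n. \<bar>b n\<bar> \<le> R"
  shows "l2norm (jacobi a b v) \<le> 3 * R * l2norm v"
proof -
  let ?x = "\<lambda>n. a (n - 1) * v (n + -1)" and ?y = "\<lambda>n. b n * v n" and ?z = "\<lambda>n. a n * v (n + 1)"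
  have f: "fin_supp ?x" "fin_supp ?y" "fin_supp ?z"
    using v by (intro fin_supp_mult fin_supp_shift; simp)+
  have "l2norm (jacobi a b v) = l2norm (\<lambda>n. ?x n + ?y n + ?z n)"
    by (simp add: jacobi_def[abs_def])
  also have "\<dots> \<le> l2norm (\<lambda>n. ?x n + ?y n) + l2norm ?z"
    using f by (intro l2norm_triangle fin_supp_add)
  also have "l2norm (\<lambda>n. ?x n + ?y n) \<le> l2norm ?x + l2norm ?y"
    using f by (intro l2norm_triangle)
  also have "l2norm ?x \<le> R * l2norm v"
    using l2norm_mult_le[OF fin_supp_shift[OF v, of "-1"], of "\<lambda>n. a (n - 1)" R] a
    by (simp only: l2norm_shift[OF v])
  also have "l2norm ?y \<le> R * l2norm v" by (rule l2norm_mult_le[OF v b])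
  also have "l2norm ?z \<le> R * l2norm v"
    using l2norm_mult_le[OF fin_supp_shift[OF v, of "1"], of a R] a
    by (simp only: l2norm_shift[OF v])
  finally show ?thesis by simp
qed

lemma fin_supp_skew: "fin_supp v \<Longrightarrow> fin_supp (skew a v)"
  using fin_supp_add[OF
    fin_supp_mult[OF fin_supp_shift[of v "-1"], of "\<lambda>n. - a (n - 1) / 2"]
    fin_supp_mult[OF fin_supp_shift[of v 1], of "\<lambda>n. a n / 2"]]
  by (simp add: skew_def[abs_def] diff_divide_distrib)

lemma l2norm_skew_le:
  assumes v: "fin_supp v" and a: "\<And>n. \<bar>a n\<bar> \<le> R"
  shows "l2norm (skew a v) \<le> R * l2norm v"
proof -
  let ?x = "\<lambda>n. - a (n - 1) / 2 * v (n + -1)" and ?z = "\<lambda>n. a n / 2 * v (n + 1)"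
  have a': "\<bar>- a (n - 1) / 2\<bar> \<le> R / 2" "\<bar>a n / 2\<bar> \<le> R / 2" for n
    using a[of "n - 1"] a[of n] by auto
  have f: "fin_supp ?x" "fin_supp ?z"
    using v by (intro fin_supp_mult fin_supp_shift; simp)+
  have "l2norm (skew a v) = l2norm (\<lambda>n. ?x n + ?z n)"
    by (simp add: skew_def[abs_def] diff_divide_distrib)
  also have "\<dots> \<le> l2norm ?x + l2norm ?z"
    using f by (intro l2norm_triangle fin_supp_add)
  also have "l2norm ?x \<le> R / 2 * l2norm v"
    using l2norm_mult_le[OF fin_supp_shift[OF v, of "-1"] a'(1)]
    by (simp only: l2norm_shift[OF v])
  also have "l2norm ?z \<le> R / 2 * l2norm v"
    using l2norm_mult_le[OF fin_supp_shift[OF v, of "1"] a'(2)]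
    by (simp only: l2norm_shift[OF v])
  finally show ?thesis by simp
qed

text \<open>Since \<open>A = skew a\<close> is skew-symmetric, \<open>h A v\<close> is orthogonal to \<open>v\<close>, and so \<open>1 + h A\<close> changes the norm
only to second order in \<open>h\<close>: it is orthogonal up to \<open>O(h\<^sup>2)\<close>.\<close>
lemma l2norm_add_skew_le:
  assumes v: "fin_supp v" and a: "\<And>n. \<bar>a n\<bar> \<le> R"
  shows "l2norm (\<lambda>n. v n + h * skew a v n) \<le> (1 + h\<^sup>2 * R\<^sup>2) * l2norm v"
proof -
  have R: "R \<ge> 0" using a[of 0] by linarith
  let ?A = "{n. v n \<noteq> 0} \<union> {n. skew a v n \<noteq> 0} \<union> {n. v (n - 1) \<noteq> 0} \<union> {n. v (n + 1) \<noteq> 0}"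
  have fin: "finite ?A"
    using v fin_supp_skew[OF v] fin_supp_shift[OF v, of "-1"] fin_supp_shift[OF v, of 1]
    by (simp add: fin_supp_def)
  \<comment> \<open>The terms of the inner product of \<open>v\<close> and \<open>skew a v\<close> telescope.\<close>
  let ?f = "\<lambda>n. a (n - 1) * v (n - 1) * v n"
  have "(\<Sum>n\<in>?A. v n * skew a v n) = (\<Sum>n\<in>?A. ?f (n + 1) / 2 - ?f n / 2)"
    by (intro sum.cong) (auto simp: skew_def field_simps)
  also have "\<dots> = (\<Sum>n\<in>?A. ?f (n + 1)) / 2 - (\<Sum>n\<in>?A. ?f n) / 2"
    by (simp only: sum_subtractf sum_divide_distrib)
  also have "(\<Sum>n\<in>?A. ?f (n + 1)) = (\<Sum>n\<in>?A. ?f n)"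
    by (rule sum_shift_fin_supp[OF fin]) auto
  finally have orth: "(\<Sum>n\<in>?A. v n * skew a v n) = 0" by simp
  have "(l2norm (\<lambda>n. v n + h * skew a v n))\<^sup>2 = (\<Sum>n\<in>?A. (v n + h * skew a v n)\<^sup>2)"
    by (rule l2norm_power2[OF fin]) auto
  also have "\<dots> = (\<Sum>n\<in>?A. (v n)\<^sup>2 + 2 * h * (v n * skew a v n) + h\<^sup>2 * (skew a v n)\<^sup>2)"
    by (intro sum.cong) (auto simp: power2_eq_square algebra_simps)
  also have "\<dots> = (\<Sum>n\<in>?A. (v n)\<^sup>2) + 2 * h * (\<Sum>n\<in>?A. v n * skew a v n) + h\<^sup>2 * (\<Sum>n\<in>?A. (skew a v n)\<^sup>2)"
    by (simp only: sum.distrib sum_distrib_left)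
  also have "(\<Sum>n\<in>?A. (v n)\<^sup>2) = (l2norm v)\<^sup>2" by (rule l2norm_power2[OF fin, symmetric]) auto
  also have "(\<Sum>n\<in>?A. (skew a v n)\<^sup>2) = (l2norm (skew a v))\<^sup>2" by (rule l2norm_power2[OF fin, symmetric]) auto
  also have "(l2norm v)\<^sup>2 + 2 * h * (\<Sum>n\<in>?A. v n * skew a v n) + h\<^sup>2 * (l2norm (skew a v))\<^sup>2
      \<le> (l2norm v)\<^sup>2 + 2 * h * (\<Sum>n\<in>?A. v n * skew a v n) + h\<^sup>2 * (R * l2norm v)\<^sup>2"
    by (intro add_left_mono mult_left_mono power_mono l2norm_skew_le v a l2norm_nonneg) simp
  also have "(l2norm v)\<^sup>2 + 2 * h * (\<Sum>n\<in>?A. v n * skew a v n) + h\<^sup>2 * (R * l2norm v)\<^sup>2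
      = (1 + h\<^sup>2 * R\<^sup>2) * (l2norm v)\<^sup>2"
    by (simp only: orth power_mult_distrib) (simp add: algebra_simps)
  also have "\<dots> \<le> (1 + h\<^sup>2 * R\<^sup>2)\<^sup>2 * (l2norm v)\<^sup>2"
    by (intro mult_right_mono) (auto simp: power2_eq_square[of "1 + _"] mult_le_cancel_left1)
  finally have "(l2norm (\<lambda>n. v n + h * skew a v n))\<^sup>2 \<le> ((1 + h\<^sup>2 * R\<^sup>2) * l2norm v)\<^sup>2"
    by (simp add: power_mult_distrib mult_left_mono)
  then show ?thesis
    by (rule power2_le_imp_le) (simp add: l2norm_nonneg)
qed

definition jacobi_norm_le :: "real \<Rightarrow> (int \<Rightarrow> real) \<Rightarrow> (int \<Rightarrow> real) \<Rightarrow> bool" where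
  "jacobi_norm_le M a b \<longleftrightarrow> (\<forall>v. fin_supp v \<longrightarrow> l2norm (jacobi a b v) \<le> M * l2norm v)"

lemma jacobi_norm_le_entries:
  assumes "jacobi_norm_le M a b"
  shows "\<bar>a n\<bar> \<le> M" "\<bar>b n\<bar> \<le> M"
proof -
  define v :: "int \<Rightarrow> real" where "v k = (if k = n then 1 else 0)" for k
  have v: "fin_supp v" by (simp add: fin_supp_def v_def)
  have "l2norm v = L2_set v {n}" by (rule l2norm_eq_L2_set) (auto simp: v_def)
  then have 1: "l2norm v = 1" by (simp add: v_def)
  let ?w = "jacobi a b v"
  have *: "\<bar>?w k\<bar> \<le> M" for k
  proof -
    let ?A = "{n. ?w n \<noteq> 0} \<union> {k}"
    have fin: "finite ?A" using fin_supp_jacobi[OF v] by (simp add: fin_supp_def)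
    have "\<bar>?w k\<bar> \<le> L2_set (\<lambda>n. \<bar>?w n\<bar>) ?A" by (rule member_le_L2_set[OF fin]) simp
    also have "\<dots> = l2norm ?w" using l2norm_eq_L2_set[OF fin, of ?w] by (simp add: L2_set_def)
    also have "\<dots> \<le> M" using assms v 1 unfolding jacobi_norm_le_def by fastforce
    finally show ?thesis .
  qed
  \<comment> \<open>The column of the matrix through the unit vector \<open>v\<close> has the entries \<open>b n\<close> and \<open>a n\<close>.\<close>
  show "\<bar>a n\<bar> \<le> M" "\<bar>b n\<bar> \<le> M"
    using *[of n] *[of "n + 1"] by (simp_all add: jacobi_def v_def)
qed

section \<open>The Lax pair and one Euler step\<close>

text \<open>The Lax pair: the right-hand side of the Toda lattice is the commutator of \<open>skew a\<close> and
\<open>jacobi a b\<close>.\<close>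
lemma jacobi_lax_identity:
  fixes a b :: "int \<Rightarrow> real"
  defines "a' \<equiv> \<lambda>n. a n / 2 * (b (n + 1) - b n)" and "b' \<equiv> \<lambda>n. (a n)\<^sup>2 - (a (n - 1))\<^sup>2"
  shows "skew a (jacobi a b v) n - jacobi a b (skew a v) n = jacobi a' b' v n"
  unfolding skew_def jacobi_def a'_def b'_def by (simp add: power2_eq_square field_simps)

lemma jacobi_add: "jacobi a b (\<lambda>k. u k + c * v k) n = jacobi a b u n + c * jacobi a b v n"
  by (simp add: jacobi_def algebra_simps)

lemma skew_add: "skew a (\<lambda>k. u k + c * v k) n = skew a u n + c * skew a v n"
  by (simp add: skew_def field_simps)

text \<open>If \<open>L = jacobi a b\<close> and \<open>A = skew a\<close>, then \<open>(1 + h A) L (1 - h A) = L + h [A, L] - h\<^sup>2 A L A\<close>. By the Lax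
identity the first two terms on the right are the Euler step of the Toda lattice, so that a sequence
within \<open>e\<close> of this step belongs to an operator which is almost orthogonally conjugate to \<open>L\<close>. Its norm
exceeds that of \<open>L\<close> by \<open>O(h\<^sup>2 + e)\<close> only.\<close>
lemma jacobi_norm_le_euler_step:
  fixes a b :: "int \<Rightarrow> real"
  defines "a' \<equiv> \<lambda>n. a n / 2 * (b (n + 1) - b n)" and "b' \<equiv> \<lambda>n. (a n)\<^sup>2 - (a (n - 1))\<^sup>2"
  assumes M: "jacobi_norm_le M a b" "M \<ge> 0"
    and a: "\<And>n. \<bar>a n\<bar> \<le> R" and b: "\<And>n. \<bar>b n\<bar> \<le> R"
    and \<alpha>: "\<And>n. \<bar>\<alpha> n - (a n + h * a' n)\<bar> \<le> e" and \<beta>: "\<And>n. \<bar>\<beta> n - (b n + h * b' n)\<bar> \<le> e"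
  shows "jacobi_norm_le (M * (1 + h\<^sup>2 * R\<^sup>2)\<^sup>2 + 3 * R ^ 3 * h\<^sup>2 + 3 * e) \<alpha> \<beta>"
  unfolding jacobi_norm_le_def
proof (intro allI impI)
  fix v assume v: "fin_supp v"
  have R: "R \<ge> 0" using a[of 0] by linarith
  let ?L = "jacobi a b" and ?A = "skew a"
  define w where "w = (\<lambda>n. v n + (- h) * ?A v n)"
  define x where "x = (\<lambda>n. ?L w n + h * ?A (?L w) n)"
  define y where "y = (\<lambda>n. h\<^sup>2 * ?A (?L (?A v)) n)"
  define z where "z = jacobi (\<lambda>n. \<alpha> n - (a n + h * a' n)) (\<lambda>n. \<beta> n - (b n + h * b' n)) v"
  have fw: "fin_supp w" unfolding w_def by (intro fin_supp_add fin_supp_mult fin_supp_skew v)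
  have fx: "fin_supp x" unfolding x_def
    by (intro fin_supp_add fin_supp_mult fin_supp_skew fin_supp_jacobi fw)
  have fy: "fin_supp y" unfolding y_def by (intro fin_supp_mult fin_supp_skew fin_supp_jacobi v)
  have fz: "fin_supp z" unfolding z_def by (intro fin_supp_jacobi v)
  have decomp: "jacobi \<alpha> \<beta> v n = x n + y n + z n" for n
  proof -
    have Lw: "?L w = (\<lambda>n. ?L v n + (- h) * ?L (?A v) n)"
      unfolding w_def by (intro ext jacobi_add)
    have "x n = ?L v n + h * (?A (?L v) n - ?L (?A v) n) - h\<^sup>2 * ?A (?L (?A v)) n"
      unfolding x_def Lw skew_add by (simp add: power2_eq_square algebra_simps)
    also have "?A (?L v) n - ?L (?A v) n = jacobi a' b' v n"
      unfolding a'_def b'_def by (rule jacobi_lax_identity)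
    finally have "x n + y n = ?L v n + h * jacobi a' b' v n" by (simp add: y_def)
    moreover have "z n = jacobi \<alpha> \<beta> v n - (?L v n + h * jacobi a' b' v n)"
      by (simp add: z_def jacobi_def algebra_simps)
    ultimately show ?thesis by simp
  qed
  let ?c = "1 + h\<^sup>2 * R\<^sup>2"
  have x: "l2norm x \<le> ?c * (M * (?c * l2norm v))"
  proof -
    have "l2norm x \<le> ?c * l2norm (?L w)"
      unfolding x_def by (intro l2norm_add_skew_le fin_supp_jacobi fw a)
    moreover have "l2norm (?L w) \<le> M * l2norm w" using M fw by (simp add: jacobi_norm_le_def)
    moreover have "l2norm w \<le> ?c * l2norm v"
      unfolding w_def using l2norm_add_skew_le[OF v a, of "- h"] by simp
    ultimately show ?thesis using M(2)
      by (meson add_nonneg_nonneg mult_left_mono mult_nonneg_nonneg order_trans zero_le_one zero_le_power2)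
  qed
  have y: "l2norm y \<le> h\<^sup>2 * (R * (3 * R * (R * l2norm v)))"
  proof -
    have "l2norm y \<le> h\<^sup>2 * l2norm (?A (?L (?A v)))"
      unfolding y_def by (intro l2norm_mult_le fin_supp_skew fin_supp_jacobi v) simp
    moreover have "l2norm (?A (?L (?A v))) \<le> R * l2norm (?L (?A v))"
      by (intro l2norm_skew_le fin_supp_skew fin_supp_jacobi v a)
    moreover have "l2norm (?L (?A v)) \<le> 3 * R * l2norm (?A v)"
      by (intro l2norm_jacobi_le fin_supp_skew v a b)
    moreover have "l2norm (?A v) \<le> R * l2norm v"
      by (intro l2norm_skew_le v a)
    moreover have "3 * R \<ge> 0" using R by simp
    ultimately show ?thesis using R
      by (meson mult_left_mono order_trans zero_le_power2)
  qed
  have "l2norm (jacobi \<alpha> \<beta> v) = l2norm (\<lambda>n. x n + y n + z n)" using decomp by presburger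
  also have "\<dots> \<le> l2norm (\<lambda>n. x n + y n) + l2norm z" by (intro l2norm_triangle fin_supp_add fx fy fz)
  also have "l2norm (\<lambda>n. x n + y n) \<le> l2norm x + l2norm y" by (intro l2norm_triangle fx fy)
  also have "l2norm x \<le> ?c * (M * (?c * l2norm v))" by (rule x)
  also have "l2norm y \<le> h\<^sup>2 * (R * (3 * R * (R * l2norm v)))" by (rule y)
  also have "l2norm z \<le> 3 * e * l2norm v"
    unfolding z_def by (intro l2norm_jacobi_le v \<alpha> \<beta>)
  finally show "l2norm (jacobi \<alpha> \<beta> v) \<le>
      (M * (1 + h\<^sup>2 * R\<^sup>2)\<^sup>2 + 3 * R ^ 3 * h\<^sup>2 + 3 * e) * l2norm v"
    using M(2) R by (simp add: power2_eq_square power3_eq_cube algebra_simps)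
qed

section \<open>Conservation of the operator norm\<close>

lemma abs_first_order_remainder_le:
  fixes f :: "real \<Rightarrow> real"
  assumes "x \<le> y" "{x..y} \<subseteq> S"
    and f: "\<And>s. s \<in> {x..y} \<Longrightarrow> (f has_real_derivative f' s) (at s within S)"
    and f': "\<And>s. s \<in> {x..y} \<Longrightarrow> (f' has_real_derivative f'' s) (at s within S)"
    and C: "\<And>s. s \<in> {x..y} \<Longrightarrow> \<bar>f'' s\<bar> \<le> C"
  shows "\<bar>f y - (f x + (y - x) * f' x)\<bar> \<le> C / 2 * (y - x)\<^sup>2"
proof -
  have f'_lip: "\<bar>f' s - f' x\<bar> \<le> C * (s - x)" if "s \<in> {x..y}" for s
    using norm_diff_le_of_derivative_bound[of x s S f' f'' "\<lambda>s. C * s" "\<lambda>s. C"] that assms(2) f' C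
    by (force simp: has_real_derivative_iff_has_vector_derivative[symmetric] algebra_simps
        intro!: derivative_eq_intros)
  have "\<bar>(\<lambda>s. f s - (f x + (s - x) * f' x)) y\<bar> \<le> (\<lambda>s. C / 2 * (s - x)\<^sup>2) y"
  proof (rule abs_le_of_derivative_bound[where x=x and y=y and S=S and
        f="\<lambda>s. f s - (f x + (s - x) * f' x)" and g="\<lambda>s. C / 2 * (s - x)\<^sup>2" and f'="\<lambda>s. f' s - f' x" and
        g'="\<lambda>s. C * (s - x)"])
    fix s assume s: "s \<in> {x..y}"
    show "((\<lambda>s. f s - (f x + (s - x) * f' x)) has_real_derivative f' s - f' x) (at s within S)"
      by (auto intro!: derivative_eq_intros f[OF s])
    show "((\<lambda>s. C / 2 * (s - x)\<^sup>2) has_real_derivative C * (s - x)) (at s within S)"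
      by (auto intro!: derivative_eq_intros)
    show "\<bar>f' s - f' x\<bar> \<le> C * (s - x)" by (rule f'_lip[OF s])
  qed (use assms in auto)
  then show ?thesis by simp
qed

text \<open>The differential equations on \<open>[0,T]\<close> without the sign condition on \<open>a\<close>; positivity of \<open>a\<close> is a
consequence of them.\<close>
definition toda_upto :: "real \<Rightarrow> (int \<Rightarrow> real \<Rightarrow> real) \<Rightarrow> (int \<Rightarrow> real \<Rightarrow> real) \<Rightarrow> bool" where
  "toda_upto T a b \<longleftrightarrow>
     (\<forall>n. \<forall>t\<in>{0..T}.
        (a n has_real_derivative a n t / 2 * (b (n + 1) t - b n t)) (at t within {0..}) \<and>
        (b n has_real_derivative (a n t)\<^sup>2 - (a (n - 1) t)\<^sup>2) (at t within {0..}))"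

lemma abs_mult_le: "\<bar>x\<bar> \<le> A \<Longrightarrow> \<bar>y\<bar> \<le> B \<Longrightarrow> \<bar>x * y\<bar> \<le> A * B" for x y A B :: real
  unfolding abs_mult by (intro mult_mono) auto

text \<open>The second derivatives of a solution are cubic polynomials in the entries, so bounded entries make
the Euler step exact up to \<open>O(h\<^sup>2)\<close>, uniformly in \<open>n\<close>.\<close>
lemma toda_taylor:
  assumes toda: "toda_upto T a b"
    and bd: "\<And>n t. t \<in> {0..T} \<Longrightarrow> \<bar>a n t\<bar> \<le> R \<and> \<bar>b n t\<bar> \<le> R"
    and s: "0 \<le> s" "0 \<le> h" "s + h \<le> T"
  shows "\<bar>a n (s + h) - (a n s + h * (a n s / 2 * (b (n + 1) s - b n s)))\<bar> \<le> 2 * R ^ 3 * h\<^sup>2"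
    and "\<bar>b n (s + h) - (b n s + h * ((a n s)\<^sup>2 - (a (n - 1) s)\<^sup>2))\<bar> \<le> 2 * R ^ 3 * h\<^sup>2"
proof -
  define a' where "a' n t = a n t / 2 * (b (n + 1) t - b n t)" for n t
  define b' where "b' n t = (a n t)\<^sup>2 - (a (n - 1) t)\<^sup>2" for n t
  define a'' where "a'' n t = a' n t / 2 * (b (n + 1) t - b n t) + a n t / 2 * (b' (n + 1) t - b' n t)" for n t
  define b'' where "b'' n t = 2 * (a n t * a' n t) - 2 * (a (n - 1) t * a' (n - 1) t)" for n t
  have R: "R \<ge> 0" using bd[of s] s by fastforce
  have da: "(a n has_real_derivative a' n t) (at t within {0..})"
    and db: "(b n has_real_derivative b' n t) (at t within {0..})" if "t \<in> {s..s+h}" for n t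
    using toda that s by (auto simp: toda_upto_def a'_def b'_def)
  have a_le: "\<bar>a n t\<bar> \<le> R" and b_le: "\<bar>b n t\<bar> \<le> R" if "t \<in> {s..s+h}" for n t
    using bd that s by auto
  have bb: "\<bar>b (n + 1) t - b n t\<bar> \<le> 2 * R" if "t \<in> {s..s+h}" for n t
    using b_le[OF that, of n] b_le[OF that, of "n + 1"] by linarith
  have a2: "\<bar>a n t / 2\<bar> \<le> R / 2" if "t \<in> {s..s+h}" for n t using a_le[OF that, of n] by simp
  have a'_le: "\<bar>a' n t\<bar> \<le> R\<^sup>2" if "t \<in> {s..s+h}" for n t
    using abs_mult_le[OF a2[OF that] bb[OF that]] by (simp add: a'_def power2_eq_square)
  have b'_le: "\<bar>b' n t\<bar> \<le> R\<^sup>2" if "t \<in> {s..s+h}" for n t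
  proof -
    have "0 \<le> (a k t)\<^sup>2" "(a k t)\<^sup>2 \<le> R\<^sup>2" for k
      using a_le[OF that, of k] R by (auto simp: abs_le_square_iff[symmetric])
    from this[of n] this[of "n - 1"] show ?thesis unfolding b'_def by linarith
  qed
  have a''_le: "\<bar>a'' n t\<bar> \<le> 4 * R ^ 3" if "t \<in> {s..s+h}" for n t
  proof -
    have "\<bar>a' n t / 2\<bar> \<le> R\<^sup>2 / 2" using a'_le[OF that, of n] by simp
    from abs_mult_le[OF this bb[OF that, of n]]
    have 1: "\<bar>a' n t / 2 * (b (n + 1) t - b n t)\<bar> \<le> R ^ 3"
      by (simp add: power2_eq_square power3_eq_cube)
    have "\<bar>b' (n + 1) t - b' n t\<bar> \<le> 2 * R\<^sup>2"
      using b'_le[OF that, of n] b'_le[OF that, of "n + 1"] by linarith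
    from abs_mult_le[OF a2[OF that, of n] this]
    have 2: "\<bar>a n t / 2 * (b' (n + 1) t - b' n t)\<bar> \<le> R ^ 3"
      by (simp add: power2_eq_square power3_eq_cube)
    have "R ^ 3 \<ge> 0" using R by simp
    with 1 2 show ?thesis unfolding a''_def by linarith
  qed
  have b''_le: "\<bar>b'' n t\<bar> \<le> 4 * R ^ 3" if "t \<in> {s..s+h}" for n t
  proof -
    have "\<bar>a k t * a' k t\<bar> \<le> R ^ 3" for k
      using abs_mult_le[OF a_le[OF that, of k] a'_le[OF that, of k]]
      by (simp add: power2_eq_square power3_eq_cube)
    from this[of n] this[of "n - 1"] show ?thesis unfolding b''_def by linarith
  qed
  have da': "(a' n has_real_derivative a'' n t) (at t within {0..})" if "t \<in> {s..s+h}" for n t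
    unfolding a'_def[abs_def] a''_def
    by (auto intro!: derivative_eq_intros da[OF that] db[OF that] simp: a'_def field_simps)
  have db': "(b' n has_real_derivative b'' n t) (at t within {0..})" if "t \<in> {s..s+h}" for n t
    unfolding b'_def[abs_def] b''_def
    by (auto intro!: derivative_eq_intros da[OF that] db[OF that] simp: algebra_simps)
  have le: "s \<le> s + h" and sub: "{s..s+h} \<subseteq> {0..}" using s by auto
  show "\<bar>a n (s + h) - (a n s + h * (a n s / 2 * (b (n + 1) s - b n s)))\<bar> \<le> 2 * R ^ 3 * h\<^sup>2"
    using abs_first_order_remainder_le[OF le sub da da' a''_le, of n] by (simp add: a'_def)
  show "\<bar>b n (s + h) - (b n s + h * ((a n s)\<^sup>2 - (a (n - 1) s)\<^sup>2))\<bar> \<le> 2 * R ^ 3 * h\<^sup>2"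
    using abs_first_order_remainder_le[OF le sub db db' b''_le, of n] by (simp add: b'_def)
qed

lemma jacobi_norm_le_mono: "jacobi_norm_le M a b \<Longrightarrow> M \<le> M' \<Longrightarrow> jacobi_norm_le M' a b"
  unfolding jacobi_norm_le_def by (meson l2norm_nonneg mult_right_mono order_trans)

text \<open>The operator norm of \<open>L\<close> is conserved. Cut \<open>[0,t]\<close> into \<open>m\<close> steps of length \<open>h = t / m\<close>. Each step
raises the norm by at most \<open>K h\<^sup>2\<close>, hence all of them by \<open>K t\<^sup>2 / m\<close>, and \<open>m\<close> is arbitrary. The bound \<open>R\<close>
on the entries enters \<open>K\<close> but not the conclusion, which is what makes the lemma an a priori bound.
Discrete steps avoid solving the linear equation for the orthogonal operators that conjugate \<open>L\<close>
at time \<open>t\<close> to \<open>L\<close> at time \<open>0\<close>.\<close>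
lemma jacobi_norm_le_conserved:
  assumes toda: "toda_upto T a b"
    and bd: "\<And>n t. t \<in> {0..T} \<Longrightarrow> \<bar>a n t\<bar> \<le> R \<and> \<bar>b n t\<bar> \<le> R"
    and M: "jacobi_norm_le M (\<lambda>n. a n 0) (\<lambda>n. b n 0)" "M \<ge> 0" and t: "t \<in> {0..T}"
  shows "jacobi_norm_le M (\<lambda>n. a n t) (\<lambda>n. b n t)"
proof -
  have R: "R \<ge> 0" using bd[OF t] by fastforce
  \<comment> \<open>\<open>M + 1\<close> bounds the norms along all steps, as their total growth \<open>K t\<^sup>2 / m\<close> is at most \<open>1\<close> below.\<close>
  define K where "K = (M + 1) * (2 * R\<^sup>2 + R ^ 4) + 9 * R ^ 3"
  have K: "K \<ge> 0" using R M(2) by (simp add: K_def)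
  have step: "jacobi_norm_le (m + K * h\<^sup>2) (\<lambda>n. a n (s + h)) (\<lambda>n. b n (s + h))"
    if m: "jacobi_norm_le m (\<lambda>n. a n s) (\<lambda>n. b n s)" "0 \<le> m" "m \<le> M + 1"
      and s: "0 \<le> s" "0 \<le> h" "h \<le> 1" "s + h \<le> T" for m s h
  proof -
    have h4: "h\<^sup>2 * h\<^sup>2 \<le> h\<^sup>2" using s by (intro mult_left_le_one_le) (auto simp: power_le_one)
    have "jacobi_norm_le (m * (1 + h\<^sup>2 * R\<^sup>2)\<^sup>2 + 3 * R ^ 3 * h\<^sup>2 + 3 * (2 * R ^ 3 * h\<^sup>2))
        (\<lambda>n. a n (s + h)) (\<lambda>n. b n (s + h))"
      using bd[of s] s
      by (intro jacobi_norm_le_euler_step[OF m(1,2)] toda_taylor[OF toda bd]) auto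
    then show ?thesis
    proof (rule jacobi_norm_le_mono)
      have "m * (1 + h\<^sup>2 * R\<^sup>2)\<^sup>2 = m + m * (2 * R\<^sup>2 * h\<^sup>2 + R ^ 4 * (h\<^sup>2 * h\<^sup>2))"
        by (simp add: power2_eq_square power4_eq_xxxx algebra_simps)
      also have "\<dots> \<le> m + (M + 1) * (2 * R\<^sup>2 * h\<^sup>2 + R ^ 4 * h\<^sup>2)"
        using m R by (intro add_left_mono mult_mono mult_left_mono h4 order_refl) auto
      finally show "m * (1 + h\<^sup>2 * R\<^sup>2)\<^sup>2 + 3 * R ^ 3 * h\<^sup>2 + 3 * (2 * R ^ 3 * h\<^sup>2) \<le> m + K * h\<^sup>2"
        by (simp add: K_def algebra_simps)
    qed
  qed
  have approx: "jacobi_norm_le (M + K * t\<^sup>2 / real m) (\<lambda>n. a n t) (\<lambda>n. b n t)"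
    if m: "m > 0" "t / m \<le> 1" "K * t\<^sup>2 / real m \<le> 1" for m :: nat
  proof -
    define h where "h = t / m"
    have h: "0 \<le> h" "h \<le> 1" using t m by (auto simp: h_def)
    have Kh: "real m * (K * h\<^sup>2) = K * t\<^sup>2 / real m" using m by (simp add: h_def power2_eq_square)
    have "jacobi_norm_le (M + real j * (K * h\<^sup>2)) (\<lambda>n. a n (real j * h)) (\<lambda>n. b n (real j * h))"
      if "j \<le> m" for j
      using that
    proof (induction j)
      case 0
      then show ?case using M by simp
    next
      case (Suc j)
      have "real j * (K * h\<^sup>2) \<le> real m * (K * h\<^sup>2)" using Suc K by (intro mult_right_mono) auto
      then have "M + real j * (K * h\<^sup>2) \<le> M + 1" using Kh m by linarith
      moreover have "real (Suc j) * h \<le> real m * h" using Suc h by (intro mult_right_mono) auto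
      then have "real (Suc j) * h \<le> T" using m t by (simp add: h_def)
      then have "real j * h + h \<le> T" by (simp add: algebra_simps)
      ultimately have "jacobi_norm_le (M + real j * (K * h\<^sup>2) + K * h\<^sup>2)
          (\<lambda>n. a n (real j * h + h)) (\<lambda>n. b n (real j * h + h))"
        using Suc M K h by (intro step) auto
      then show ?case by (simp add: algebra_simps)
    qed
    from this[of m] show ?thesis using m Kh by (simp add: h_def)
  qed
  show ?thesis unfolding jacobi_norm_le_def
  proof (intro allI impI)
    fix v assume v: "fin_supp v"
    let ?x = "l2norm (jacobi (\<lambda>n. a n t) (\<lambda>n. b n t) v)"
    have lim: "(\<lambda>m. c / real m) \<longlonglongrightarrow> 0" for c
      by (rule lim_const_over_n)
    have "\<forall>\<^sub>F m in sequentially. c / real m \<le> 1" for c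
      using order_tendstoD(2)[OF lim[of c] zero_less_one] by (rule eventually_mono) simp
    then have "\<forall>\<^sub>F m in sequentially. t / real m \<le> 1 \<and> K * t\<^sup>2 / real m \<le> 1 \<and> m > 0"
      by (intro eventually_conj eventually_gt_at_top)
    then have ev: "\<forall>\<^sub>F m in sequentially. ?x \<le> (M + K * t\<^sup>2 / real m) * l2norm v"
    proof eventually_elim
      case (elim m)
      then show ?case using approx[of m] v unfolding jacobi_norm_le_def by blast
    qed
    have "(\<lambda>m. (M + K * t\<^sup>2 / real m) * l2norm v) \<longlonglongrightarrow> (M + 0) * l2norm v"
      by (intro tendsto_intros lim)
    from tendsto_lowerbound[OF this ev] show "?x \<le> M * l2norm v" by simp
  qed
qed

section \<open>Global existence of bounded solutions\<close>

definition clip :: "real \<Rightarrow> real \<Rightarrow> real" where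
  "clip R x = max (- R) (min R x)"

lemma clip_dist: "\<bar>clip R x - clip R y\<bar> \<le> \<bar>x - y\<bar>"
  by (auto simp: clip_def max_def min_def)

lemma clip_le: "R \<ge> 0 \<Longrightarrow> \<bar>clip R x\<bar> \<le> R"
  by (auto simp: clip_def max_def min_def)

lemma clip_eq: "\<bar>x\<bar> \<le> R \<Longrightarrow> clip R x = x"
  by (auto simp: clip_def max_def min_def)

instance bcontfun :: (metric_space, banach) banach ..

instance discrete :: (type) discrete_topology
  by standard (rule Discrete_Topology.open_discrete)

text \<open>The Banach space \<open>\<ell>\<^sup>\<infinity>(\<int>)\<close> is obtained as the space of bounded continuous functions on a discrete
metric space of indices.\<close>
definition bounded_family :: "(int \<Rightarrow> 'b::metric_space) \<Rightarrow> int discrete \<Rightarrow>\<^sub>C 'b" where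
  "bounded_family f = Bcontfun (\<lambda>k. f (of_discrete k))"

lemma apply_bounded_family:
  fixes f :: "int \<Rightarrow> 'b::real_normed_vector"
  assumes "\<And>n. norm (f n) \<le> C"
  shows "apply_bcontfun (bounded_family f) (discrete n) = f n"
proof -
  have "(\<lambda>k. f (of_discrete k)) \<in> bcontfun"
    by (rule bcontfun_normI[of _ C]) (auto simp: assms)
  then show ?thesis by (simp add: bounded_family_def Bcontfun_inverse discrete_inverse)
qed

lemma bounded_linear_apply_bcontfun: "bounded_linear (\<lambda>f. apply_bcontfun f x)"
  by (rule bounded_linear_intro[where K=1]) (auto simp: norm_bounded)

text \<open>After clipping all entries at \<open>R\<close> the vector field is globally Lipschitz on \<open>\<ell>\<^sup>\<infinity>(\<int>)\<close> and the
half-line Picard theorem applies.\<close>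
lemma clipped_toda_exists:
  assumes R: "R \<ge> 0" and a0: "\<And>n. \<bar>a0 n\<bar> \<le> C" and b0: "\<And>n. \<bar>b0 n\<bar> \<le> C"
  obtains a b :: "int \<Rightarrow> real \<Rightarrow> real" where "\<And>n. a n 0 = a0 n" "\<And>n. b n 0 = b0 n"
    and "\<And>n t. t \<ge> 0 \<Longrightarrow> (a n has_real_derivative
        clip R (a n t) / 2 * (clip R (b (n + 1) t) - clip R (b n t))) (at t within {0..})"
    and "\<And>n t. t \<ge> 0 \<Longrightarrow> (b n has_real_derivative
        (clip R (a n t))\<^sup>2 - (clip R (a (n - 1) t))\<^sup>2) (at t within {0..})"
proof -
  define F1 where "F1 u n = clip R (fst (u n)) / 2 * (clip R (snd (u (n + 1))) - clip R (snd (u n)))"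
    for u :: "int \<Rightarrow> real \<times> real" and n
  define F2 where "F2 u n = (clip R (fst (u n)))\<^sup>2 - (clip R (fst (u (n - 1))))\<^sup>2"
    for u :: "int \<Rightarrow> real \<times> real" and n
  define F where "F u = bounded_family (\<lambda>n. (F1 (\<lambda>n. u (discrete n)) n, F2 (\<lambda>n. u (discrete n)) n))"
    for u :: "int discrete \<Rightarrow>\<^sub>C (real \<times> real)"
  define x0 where "x0 = bounded_family (\<lambda>n. (a0 n, b0 n))"
  have c: "\<bar>clip R x\<bar> \<le> R" "\<bar>clip R x / 2\<bar> \<le> R / 2" "\<bar>clip R x - clip R y\<bar> \<le> 2 * R"
    "\<bar>clip R x + clip R y\<bar> \<le> 2 * R" for x y
    using clip_le[OF R, of x] clip_le[OF R, of y] by auto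
  have "norm (F1 u n, F2 u n) \<le> R / 2 * (2 * R) + 2 * R * (2 * R)" for u n
  proof -
    have 1: "\<bar>F1 u n\<bar> \<le> R / 2 * (2 * R)" unfolding F1_def by (intro abs_mult_le c)
    have 2: "\<bar>F2 u n\<bar> \<le> 2 * R * (2 * R)"
      unfolding F2_def power2_eq_square square_diff_square_factored by (intro abs_mult_le c)
    show ?thesis
      using norm_Pair_le[of "F1 u n" "F2 u n"] 1 2 unfolding real_norm_def by linarith
  qed
  then have F_app: "apply_bcontfun (F u) (discrete n) =
      (F1 (\<lambda>n. u (discrete n)) n, F2 (\<lambda>n. u (discrete n)) n)" for u n
    unfolding F_def by (rule apply_bounded_family)
  have "norm (a0 n, b0 n) \<le> C + C" for n
    using norm_Pair_le[of "a0 n" "b0 n"] a0[of n] b0[of n] by simp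
  then have x0_app: "apply_bcontfun x0 (discrete n) = (a0 n, b0 n)" for n
    unfolding x0_def by (rule apply_bounded_family)
  have "norm (F u - F w) \<le> (6 * R) * norm (u - w)" for u w
  proof (rule norm_bound)
    fix m :: "int discrete"
    define n where "n = of_discrete m"
    have m: "m = discrete n" by (simp add: n_def of_discrete_inverse)
    let ?u = "\<lambda>n. apply_bcontfun u (discrete n)" and ?w = "\<lambda>n. apply_bcontfun w (discrete n)" and ?D = "norm (u - w)"
    have "norm (?u k - ?w k) \<le> ?D" for k
      using norm_bounded[of "u - w" "discrete k"] by simp
    moreover have "\<bar>fst z\<bar> \<le> norm z \<and> \<bar>snd z\<bar> \<le> norm z" for z :: "real \<times> real"
      using norm_fst_le[of "fst z" "snd z"] norm_snd_le[of "snd z" "fst z"] by simp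
    from this[of "?u k - ?w k" for k]
    have "\<bar>fst (?u k) - fst (?w k)\<bar> \<le> norm (?u k - ?w k)" "\<bar>snd (?u k) - snd (?w k)\<bar> \<le> norm (?u k - ?w k)" for k
      by simp_all
    ultimately have "\<bar>fst (?u k) - fst (?w k)\<bar> \<le> ?D" "\<bar>snd (?u k) - snd (?w k)\<bar> \<le> ?D" for k
      by (meson order_trans)+
    then have d: "\<bar>clip R (fst (?u k)) - clip R (fst (?w k))\<bar> \<le> ?D"
      "\<bar>clip R (snd (?u k)) - clip R (snd (?w k))\<bar> \<le> ?D" for k
      by (meson clip_dist order_trans)+
    let ?a = "\<lambda>k. clip R (fst (?u k))" and ?a' = "\<lambda>k. clip R (fst (?w k))"
    let ?b = "\<lambda>k. clip R (snd (?u k))" and ?b' = "\<lambda>k. clip R (snd (?w k))"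
    \<comment> \<open>Both components of the vector field are products; one factor is changed at a time.\<close>
    have "F1 ?u n - F1 ?w n = (?a n - ?a' n) * ((?b (n+1) - ?b n) / 2)
        + ?a' n / 2 * (?b (n+1) - ?b' (n+1)) - ?a' n / 2 * (?b n - ?b' n)"
      unfolding F1_def by (simp add: field_simps)
    moreover have "\<bar>(?a n - ?a' n) * ((?b (n+1) - ?b n) / 2)\<bar> \<le> ?D * R"
      using c(3)[of "snd (?u (n+1))" "snd (?u n)"] by (intro abs_mult_le d) simp
    moreover have "\<bar>?a' n / 2 * (?b (n+1) - ?b' (n+1))\<bar> \<le> R / 2 * ?D"
      "\<bar>?a' n / 2 * (?b n - ?b' n)\<bar> \<le> R / 2 * ?D"
      by (intro abs_mult_le d c)+
    ultimately have 1: "\<bar>F1 ?u n - F1 ?w n\<bar> \<le> 2 * R * ?D"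
      by (simp only: mult.commute[of ?D R])
    have sq: "\<bar>(?a k)\<^sup>2 - (?a' k)\<^sup>2\<bar> \<le> (2 * R) * ?D" for k
      unfolding power2_eq_square square_diff_square_factored by (intro abs_mult_le d c)
    have "F2 ?u n - F2 ?w n = ((?a n)\<^sup>2 - (?a' n)\<^sup>2) - ((?a (n-1))\<^sup>2 - (?a' (n-1))\<^sup>2)"
      unfolding F2_def by simp
    with sq[of n] sq[of "n - 1"] have 2: "\<bar>F2 ?u n - F2 ?w n\<bar> \<le> 4 * R * ?D" by linarith
    have "apply_bcontfun (F u - F w) m = (F1 ?u n - F1 ?w n, F2 ?u n - F2 ?w n)"
      by (simp add: F_app m)
    with 1 2 norm_Pair_le[of "F1 ?u n - F1 ?w n" "F2 ?u n - F2 ?w n"]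
    show "norm (apply_bcontfun (F u - F w) m) \<le> 6 * R * ?D" by simp
  qed
  then obtain u where u0: "u 0 = x0"
    and u: "\<And>t. t \<ge> 0 \<Longrightarrow> (u has_vector_derivative F (u t)) (at t within {0..})"
    using picard_lipschitz_halfline[of F "6 * R" x0] by blast
  define a where "a n t = fst (apply_bcontfun (u t) (discrete n))" for n t
  define b where "b n t = snd (apply_bcontfun (u t) (discrete n))" for n t
  have comp: "((\<lambda>t. apply_bcontfun (u t) (discrete n)) has_vector_derivative
      apply_bcontfun (F (u t)) (discrete n)) (at t within {0..})" if "t \<ge> 0" for t n
    by (rule bounded_linear.has_vector_derivative[OF bounded_linear_apply_bcontfun u[OF that]])
  show thesis
  proof
    show "a n 0 = a0 n" "b n 0 = b0 n" for n by (simp_all add: a_def b_def u0 x0_app)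
    fix n and t :: real assume t: "t \<ge> 0"
    show "(a n has_real_derivative
        clip R (a n t) / 2 * (clip R (b (n + 1) t) - clip R (b n t))) (at t within {0..})"
      using bounded_linear.has_vector_derivative[OF bounded_linear_fst comp[OF t, of n]]
      by (simp add: F_app F1_def a_def[abs_def] b_def has_real_derivative_iff_has_vector_derivative)
    show "(b n has_real_derivative
        (clip R (a n t))\<^sup>2 - (clip R (a (n - 1) t))\<^sup>2) (at t within {0..})"
      using bounded_linear.has_vector_derivative[OF bounded_linear_snd comp[OF t, of n]]
      by (simp add: F_app F2_def a_def b_def[abs_def] has_real_derivative_iff_has_vector_derivative)
  qed
qed

text \<open>Bootstrap: the entries of the clipped solution are bounded by the initial operator norm \<open>L\<close> as long as
clipping at \<open>R = L + 1\<close> is inactive. They move with speed at most \<open>V\<close>, uniformly in \<open>n\<close>, so a bound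
by \<open>L\<close> on \<open>[0, k / V]\<close> gives the bound by \<open>R\<close> on \<open>[0, (k + 1) / V]\<close>; there the clipped solution
solves the Toda lattice, and conservation of the norm restores the bound by \<open>L\<close>.\<close>
lemma toda_bounded_solution_exists:
  assumes a0: "\<And>n. \<bar>a0 n\<bar> \<le> C" and b0: "\<And>n. \<bar>b0 n\<bar> \<le> C"
  obtains a b :: "int \<Rightarrow> real \<Rightarrow> real" and R
  where "\<And>n. a n 0 = a0 n" "\<And>n. b n 0 = b0 n" "\<And>T. toda_upto T a b"
    and "\<And>n t. t \<ge> 0 \<Longrightarrow> \<bar>a n t\<bar> \<le> R" "\<And>n t. t \<ge> 0 \<Longrightarrow> \<bar>b n t\<bar> \<le> R"
proof -
  have C: "C \<ge> 0" using a0[of 0] by linarith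
  define L where "L = 3 * C"
  define R where "R = L + 1"
  have LR: "0 \<le> L" "C \<le> L" "0 \<le> R" "L \<le> R" using C by (auto simp: L_def R_def)
  obtain a b :: "int \<Rightarrow> real \<Rightarrow> real" where init: "\<And>n. a n 0 = a0 n" "\<And>n. b n 0 = b0 n"
    and da: "\<And>n t. t \<ge> 0 \<Longrightarrow> (a n has_real_derivative
        clip R (a n t) / 2 * (clip R (b (n + 1) t) - clip R (b n t))) (at t within {0..})"
    and db: "\<And>n t. t \<ge> 0 \<Longrightarrow> (b n has_real_derivative
        (clip R (a n t))\<^sup>2 - (clip R (a (n - 1) t))\<^sup>2) (at t within {0..})"
    using clipped_toda_exists[of R a0 C b0, OF LR(3) a0 b0] by blast
  have c: "\<bar>clip R x\<bar> \<le> R" "\<bar>clip R x / 2\<bar> \<le> R / 2" "\<bar>clip R x - clip R y\<bar> \<le> 2 * R"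
    "\<bar>clip R x + clip R y\<bar> \<le> 2 * R" for x y
    using clip_le[OF LR(3), of x] clip_le[OF LR(3), of y] by auto
  define V where "V = 4 * R\<^sup>2 + 1"
  have V: "V > 0" by (simp add: V_def add_nonneg_pos)
  have speed: "\<bar>a n t - a n s\<bar> \<le> V * (t - s) \<and> \<bar>b n t - b n s\<bar> \<le> V * (t - s)" if "0 \<le> s" "s \<le> t" for n s t
  proof -
    have V1: "\<bar>clip R (a n r) / 2 * (clip R (b (n + 1) r) - clip R (b n r))\<bar> \<le> V" for r
      by (rule order_trans[OF abs_mult_le[OF c(2,3)]]) (auto simp: V_def power2_eq_square)
    have V2: "\<bar>(clip R (a n r))\<^sup>2 - (clip R (a (n - 1) r))\<^sup>2\<bar> \<le> V" for r
      unfolding power2_eq_square square_diff_square_factored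
      by (rule order_trans[OF abs_mult_le[OF c(4,3)]]) (auto simp: V_def power2_eq_square)
    have "norm (a n t - a n s) \<le> V * t - V * s"
      by (rule norm_diff_le_of_derivative_bound[where S="{0..}" and g'="\<lambda>_. V" and
            f'="\<lambda>r. clip R (a n r) / 2 * (clip R (b (n + 1) r) - clip R (b n r))"])
        (use that da V1 in \<open>auto simp: has_real_derivative_iff_has_vector_derivative[symmetric] intro!: derivative_eq_intros\<close>)
    moreover have "norm (b n t - b n s) \<le> V * t - V * s"
      by (rule norm_diff_le_of_derivative_bound[where S="{0..}" and g'="\<lambda>_. V" and
            f'="\<lambda>r. (clip R (a n r))\<^sup>2 - (clip R (a (n - 1) r))\<^sup>2"])
        (use that db V2 in \<open>auto simp: has_real_derivative_iff_has_vector_derivative[symmetric] intro!: derivative_eq_intros\<close>)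
    ultimately show ?thesis by (simp add: algebra_simps)
  qed
  have toda: "toda_upto T a b" if "\<And>n t. t \<in> {0..T} \<Longrightarrow> \<bar>a n t\<bar> \<le> R \<and> \<bar>b n t\<bar> \<le> R" for T
    unfolding toda_upto_def
  proof (intro allI ballI)
    fix n t assume t: "t \<in> {0..T}"
    then show "(a n has_real_derivative a n t / 2 * (b (n + 1) t - b n t)) (at t within {0..}) \<and>
        (b n has_real_derivative (a n t)\<^sup>2 - (a (n - 1) t)\<^sup>2) (at t within {0..})"
      using da[of t n] db[of t n] that[OF t] by (simp add: clip_eq)
  qed
  have init_norm: "jacobi_norm_le L (\<lambda>n. a n 0) (\<lambda>n. b n 0)"
    unfolding jacobi_norm_le_def L_def using l2norm_jacobi_le[of _ a0 C b0] a0 b0 by (simp add: init)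
  have boot: "\<bar>a n t\<bar> \<le> L \<and> \<bar>b n t\<bar> \<le> L" if "t \<in> {0..real k / V}" for n t k
    using that
  proof (induction k arbitrary: n t)
    case 0
    then show ?case using a0[of n] b0[of n] LR by (simp add: init)
  next
    case (Suc k)
    let ?T = "real (Suc k) / V" and ?s = "real k / V"
    have s: "?s \<ge> 0" using V by simp
    have bd: "\<bar>a n t\<bar> \<le> R \<and> \<bar>b n t\<bar> \<le> R" if t: "t \<in> {0..?T}" for n t
    proof (cases "t \<le> ?s")
      case True
      then show ?thesis using Suc.IH[of t n] t LR by auto
    next
      case False
      have "V * (t - ?s) \<le> V * (?T - ?s)" using t V by (intro mult_left_mono) auto
      also have "\<dots> = 1" using V by (simp add: field_simps)
      finally have "V * (t - ?s) \<le> 1" .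
      moreover have "\<bar>a n ?s\<bar> \<le> L \<and> \<bar>b n ?s\<bar> \<le> L" by (rule Suc.IH) (use s in auto)
      moreover have "\<bar>a n t - a n ?s\<bar> \<le> V * (t - ?s) \<and> \<bar>b n t - b n ?s\<bar> \<le> V * (t - ?s)"
        using speed[of ?s t n] False s by simp
      ultimately show ?thesis unfolding R_def by linarith
    qed
    show ?case
      using jacobi_norm_le_entries[OF jacobi_norm_le_conserved[OF toda[OF bd] bd init_norm LR(1) Suc.prems]] by simp
  qed
  have L: "\<bar>a n t\<bar> \<le> L \<and> \<bar>b n t\<bar> \<le> L" if "t \<ge> 0" for n t
  proof -
    obtain k :: nat where "t * V < real k" using reals_Archimedean2 by blast
    then have "t \<in> {0..real k / V}" using that V by (simp add: field_simps)
    then show ?thesis by (rule boot)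
  qed
  have "\<bar>a n t\<bar> \<le> R \<and> \<bar>b n t\<bar> \<le> R" if "t \<in> {0..T}" for n t T
    using L[of t n] LR(4) that by simp
  then have "toda_upto T a b" for T by (rule toda)
  from that[OF init this] show thesis using L by blast
qed

section \<open>Positivity, decay and uniqueness of bounded solutions\<close>

text \<open>The function \<open>f\<^sup>2 exp (2 K t)\<close> is nondecreasing, so \<open>f\<close> has no zero and keeps its sign.\<close>
lemma linear_ode_positive:
  fixes f g :: "real \<Rightarrow> real"
  assumes der: "\<And>s. s \<in> {0..t} \<Longrightarrow> (f has_real_derivative f s * g s) (at s within {0..})"
    and g: "\<And>s. s \<in> {0..t} \<Longrightarrow> \<bar>g s\<bar> \<le> K" and "f 0 > 0" and t: "t \<ge> 0"
  shows "f t > 0"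
proof -
  have nz: "f s \<noteq> 0" if s: "s \<in> {0..t}" for s
  proof -
    let ?h = "\<lambda>r. (f r)\<^sup>2 * exp (2 * K * r)"
    have "norm ((\<lambda>_. 0 :: real) s - (\<lambda>_. 0) 0) \<le> ?h s - ?h 0"
    proof (rule norm_diff_le_of_derivative_bound[where S="{0..}" and x=0 and y=s and f="\<lambda>_. 0" and g="?h" and f'="\<lambda>_. 0" and
          g'="\<lambda>r. 2 * (f r)\<^sup>2 * exp (2 * K * r) * (g r + K)"])
      fix r assume "r \<in> {0..s}"
      then have r: "r \<in> {0..t}" using s by auto
      show "(?h has_real_derivative 2 * (f r)\<^sup>2 * exp (2 * K * r) * (g r + K)) (at r within {0..})"
        by (auto intro!: derivative_eq_intros der[OF r] simp: power2_eq_square algebra_simps)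
      show "norm (0::real) \<le> 2 * (f r)\<^sup>2 * exp (2 * K * r) * (g r + K)"
        using g[OF r] by simp
    qed (use s in auto)
    moreover have "?h 0 > 0" using \<open>f 0 > 0\<close> by simp
    ultimately show ?thesis by auto
  qed
  show ?thesis
  proof (rule ccontr)
    assume "\<not> f t > 0"
    then have "f t \<le> 0" by simp
    moreover have "continuous_on {0..t} f"
      by (rule DERIV_continuous_on, rule has_field_derivative_subset[OF der]) auto
    ultimately obtain x where "0 \<le> x" "x \<le> t" "f x = 0"
      using IVT2'[of f t 0 0] \<open>f 0 > 0\<close> t by auto
    then show False using nz by auto
  qed
qed

text \<open>Decay at \<open>+\<infinity>\<close> is inherited from the initial data at the same site and its left neighbour: \<open>a n\<close>
satisfies a linear equation with bounded coefficient, and then the derivative of \<open>b n\<close> is controlled by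
\<open>a n\<close> and \<open>a (n - 1)\<close>.\<close>
lemma toda_right_bound:
  assumes toda: "toda_upto T a b"
    and bd: "\<And>n t. t \<in> {0..T} \<Longrightarrow> \<bar>a n t\<bar> \<le> R" "\<And>n t. t \<in> {0..T} \<Longrightarrow> \<bar>b n t\<bar> \<le> R"
    and t: "t \<in> {0..T}"
  shows "\<bar>a n t\<bar> \<le> \<bar>a n 0\<bar> * exp (R * T)"
    and "\<bar>b n t\<bar> \<le> \<bar>b n 0\<bar> + ((\<bar>a n 0\<bar> * exp (R * T))\<^sup>2 + (\<bar>a (n - 1) 0\<bar> * exp (R * T))\<^sup>2) * T"
proof -
  have R: "R \<ge> 0" using bd(1)[OF t] by (meson abs_ge_zero order_trans)
  have a_le: "\<bar>a n s\<bar> \<le> \<bar>a n 0\<bar> * exp (R * T)" if s: "s \<in> {0..T}" for n s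
  proof -
    have "\<bar>a n s\<bar> \<le> \<bar>a n 0\<bar> * exp (R * 1 * s)"
    proof (rule abs_le_exp_of_neighbour_growth[where N="\<lambda>n. {n}" and T=T and M=R and f=a and
          f'="\<lambda>n t. a n t / 2 * (b (n + 1) t - b n t)" and Z="\<lambda>n. \<bar>a n 0\<bar>"])
      fix n r B assume r: "r \<in> {0..T}" and "\<And>j. j \<in> {n} \<Longrightarrow> \<bar>a j r\<bar> \<le> B"
      then have 1: "\<bar>a n r\<bar> \<le> B" by simp
      have 2: "\<bar>(b (n + 1) r - b n r) / 2\<bar> \<le> R"
        using bd(2)[OF r, of n] bd(2)[OF r, of "n + 1"] by auto
      show "\<bar>a n r / 2 * (b (n + 1) r - b n r)\<bar> \<le> R * B"
        using abs_mult_le[OF 2 1] by (simp add: mult.commute)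
    qed (use toda bd R s in \<open>auto simp: toda_upto_def\<close>)
    also have "\<dots> \<le> \<bar>a n 0\<bar> * exp (R * T)"
      using s R by (intro mult_left_mono) (auto intro: mult_left_mono)
    finally show ?thesis .
  qed
  then show "\<bar>a n t\<bar> \<le> \<bar>a n 0\<bar> * exp (R * T)" using t .
  define A where "A n = (\<bar>a n 0\<bar> * exp (R * T))\<^sup>2" for n
  have "\<bar>b n t\<bar> \<le> \<bar>b n 0\<bar> + (A n + A (n - 1)) * t"
  proof (rule abs_le_of_derivative_bound[where S="{0..}" and x=0 and y=t and f="b n" and
        g="\<lambda>s. \<bar>b n 0\<bar> + (A n + A (n - 1)) * s" and
        f'="\<lambda>s. (a n s)\<^sup>2 - (a (n - 1) s)\<^sup>2" and g'="\<lambda>_. A n + A (n - 1)"])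
    fix s assume "s \<in> {0..t}"
    then have s: "s \<in> {0..T}" using t by auto
    show "(b n has_real_derivative (a n s)\<^sup>2 - (a (n - 1) s)\<^sup>2) (at s within {0..})"
      using toda s by (simp add: toda_upto_def)
    show "((\<lambda>s. \<bar>b n 0\<bar> + (A n + A (n - 1)) * s) has_real_derivative A n + A (n - 1)) (at s within {0..})"
      by (auto intro!: derivative_eq_intros)
    have "0 \<le> (a k s)\<^sup>2 \<and> (a k s)\<^sup>2 \<le> A k" for k
      using power_mono[OF a_le[OF s, of k], of 2] by (simp add: A_def)
    from this[of n] this[of "n - 1"]
    show "\<bar>(a n s)\<^sup>2 - (a (n - 1) s)\<^sup>2\<bar> \<le> A n + A (n - 1)" by linarith
  qed (use t in auto)
  also have "\<dots> \<le> \<bar>b n 0\<bar> + (A n + A (n - 1)) * T"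
    using t by (intro add_left_mono mult_left_mono) (auto simp: A_def)
  finally show "\<bar>b n t\<bar> \<le> \<bar>b n 0\<bar> + ((\<bar>a n 0\<bar> * exp (R * T))\<^sup>2 + (\<bar>a (n - 1) 0\<bar> * exp (R * T))\<^sup>2) * T"
    by (simp add: A_def)
qed

text \<open>The deviations \<open>a n - 1\<close> and \<open>b n\<close> from the constant solution \<open>a = 1\<close>, \<open>b = 0\<close> satisfy a linear
system with bounded coefficients and nearest-neighbour coupling; the factorization
\<open>a\<^sup>2 - 1 = (a - 1) (a + 1)\<close> makes this visible. Both families are combined into one, indexed by
\<open>int \<times> bool\<close>.\<close>
lemma toda_left_bound:
  assumes toda: "toda_upto T a b"
    and bd: "\<And>n t. t \<in> {0..T} \<Longrightarrow> \<bar>a n t\<bar> \<le> R" "\<And>n t. t \<in> {0..T} \<Longrightarrow> \<bar>b n t\<bar> \<le> R"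
    and Z: "\<And>n. \<bar>a n 0 - 1\<bar> \<le> Z n" "\<And>n. \<bar>b n 0\<bar> \<le> Z n"
    and slow: "\<And>n. Z (n + 1) \<le> q * Z n" "\<And>n. Z n \<le> q * Z (n + 1)" and q: "q \<ge> 1"
    and t: "t \<in> {0..T}"
  shows "\<bar>a n t - 1\<bar> \<le> Z n * exp (2 * (R + 1) * q * t)" "\<bar>b n t\<bar> \<le> Z n * exp (2 * (R + 1) * q * t)"
proof -
  have R: "R \<ge> 0" using bd(1)[OF t] by (meson abs_ge_zero order_trans)
  have Z0: "Z n \<ge> 0" for n using Z(2)[of n] by linarith
  define f :: "int \<times> bool \<Rightarrow> real \<Rightarrow> real"
    where "f = (\<lambda>(n, left) t. if left then a n t - 1 else b n t)"
  define f' :: "int \<times> bool \<Rightarrow> real \<Rightarrow> real"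
    where "f' = (\<lambda>(n, left) t. if left then a n t / 2 * (b (n + 1) t - b n t) else (a n t)\<^sup>2 - (a (n - 1) t)\<^sup>2)"
  define N :: "int \<times> bool \<Rightarrow> (int \<times> bool) set"
    where "N = (\<lambda>(n, _). {n - 1, n, n + 1} \<times> UNIV)"
  have "\<bar>f i t\<bar> \<le> Z (fst i) * exp (2 * (R + 1) * q * t)" for i
  proof (rule abs_le_exp_of_neighbour_growth[where N=N and f'=f' and T=T and Z="\<lambda>i. Z (fst i)" and M="R + 1"])
    fix i :: "int \<times> bool" and r assume r: "r \<in> {0..T}"
    obtain n l where i: "i = (n, l)" by (cases i)
    have "(a n has_real_derivative a n r / 2 * (b (n + 1) r - b n r)) (at r within {0..})"
      "(b n has_real_derivative (a n r)\<^sup>2 - (a (n - 1) r)\<^sup>2) (at r within {0..})"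
      using toda r by (auto simp: toda_upto_def)
    then show "(f i has_real_derivative f' i r) (at r within {0..})"
      by (cases l) (auto simp: i f_def f'_def intro!: derivative_eq_intros)
    show "\<bar>f i r\<bar> \<le> R + 1" using bd(1)[OF r, of n] bd(2)[OF r, of n] by (auto simp: i f_def)
    fix B assume B: "\<And>j. j \<in> N i \<Longrightarrow> \<bar>f j r\<bar> \<le> B"
    have xb: "\<bar>a k r - 1\<bar> \<le> B" "\<bar>b k r\<bar> \<le> B" if "k \<in> {n - 1, n, n + 1}" for k
      using B[of "(k, True)"] B[of "(k, False)"] that by (auto simp: i N_def f_def)
    have B0: "B \<ge> 0" using xb(2)[of n] by simp
    have "\<bar>a n r / 2\<bar> \<le> R + 1" using bd(1)[OF r, of n] by simp
    moreover have "\<bar>b (n + 1) r - b n r\<bar> \<le> 2 * B" using xb(2)[of n] xb(2)[of "n + 1"] by simp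
    ultimately have 1: "\<bar>a n r / 2 * (b (n + 1) r - b n r)\<bar> \<le> (R + 1) * (2 * B)" by (rule abs_mult_le)
    have sq: "\<bar>(a k r - 1) * (a k r + 1)\<bar> \<le> B * (R + 1)" if "k \<in> {n - 1, n, n + 1}" for k
      using bd(1)[OF r, of k] by (intro abs_mult_le xb that) auto
    have "(a n r)\<^sup>2 - (a (n - 1) r)\<^sup>2 = (a n r - 1) * (a n r + 1) - (a (n - 1) r - 1) * (a (n - 1) r + 1)"
      by (simp add: power2_eq_square algebra_simps)
    moreover have "\<bar>(a n r - 1) * (a n r + 1)\<bar> \<le> B * (R + 1)"
      "\<bar>(a (n - 1) r - 1) * (a (n - 1) r + 1)\<bar> \<le> B * (R + 1)" by (rule sq; simp)+
    ultimately have 2: "\<bar>(a n r)\<^sup>2 - (a (n - 1) r)\<^sup>2\<bar> \<le> 2 * (B * (R + 1))"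
      by linarith
    show "\<bar>f' i r\<bar> \<le> 2 * (R + 1) * B" using 1 2 by (cases l) (auto simp: i f'_def algebra_simps)
  next
    fix i j :: "int \<times> bool" assume "j \<in> N i"
    then consider "fst j = fst i - 1" | "fst j = fst i" | "fst j = fst i + 1" by (auto simp: N_def split: prod.splits)
    then show "Z (fst j) \<le> q * Z (fst i)"
    proof cases
      case 1
      then show ?thesis using slow(2)[of "fst j"] by simp
    next
      case 2
      then show ?thesis using q Z0[of "fst i"] by (simp add: mult_le_cancel_right1)
    next
      case 3
      then show ?thesis using slow(1)[of "fst i"] by simp
    qed
  next
    fix i :: "int \<times> bool" show "\<bar>f i 0\<bar> \<le> Z (fst i)" using Z[of "fst i"] by (auto simp: f_def split: prod.splits)
  qed (use t R in auto)
  from this[of "(n, True)"] this[of "(n, False)"]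
  show "\<bar>a n t - 1\<bar> \<le> Z n * exp (2 * (R + 1) * q * t)" "\<bar>b n t\<bar> \<le> Z n * exp (2 * (R + 1) * q * t)"
    by (simp_all add: f_def)
qed

text \<open>The differences of two bounded solutions satisfy a linear system with bounded coefficients and
nearest-neighbour coupling, and start at \<open>Z = 0\<close>.\<close>
lemma toda_bounded_solutions_unique:
  assumes toda: "toda_upto T a b" "toda_upto T a' b'"
    and bd: "\<And>n t. t \<in> {0..T} \<Longrightarrow> \<bar>a n t\<bar> \<le> R \<and> \<bar>b n t\<bar> \<le> R"
      "\<And>n t. t \<in> {0..T} \<Longrightarrow> \<bar>a' n t\<bar> \<le> R \<and> \<bar>b' n t\<bar> \<le> R"
    and init: "\<And>n. a n 0 = a' n 0" "\<And>n. b n 0 = b' n 0"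
    and t: "t \<in> {0..T}"
  shows "a n t = a' n t" "b n t = b' n t"
proof -
  have R: "R \<ge> 0" using bd(1)[OF t] by (meson abs_ge_zero order_trans)
  define f :: "int \<times> bool \<Rightarrow> real \<Rightarrow> real"
    where "f = (\<lambda>(n, left) t. if left then a n t - a' n t else b n t - b' n t)"
  define f' :: "int \<times> bool \<Rightarrow> real \<Rightarrow> real"
    where "f' = (\<lambda>(n, left) t. if left
      then a n t / 2 * (b (n + 1) t - b n t) - a' n t / 2 * (b' (n + 1) t - b' n t)
      else ((a n t)\<^sup>2 - (a (n - 1) t)\<^sup>2) - ((a' n t)\<^sup>2 - (a' (n - 1) t)\<^sup>2))"
  define N :: "int \<times> bool \<Rightarrow> (int \<times> bool) set"
    where "N = (\<lambda>(n, _). {n - 1, n, n + 1} \<times> UNIV)"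
  have "\<bar>f i t\<bar> \<le> 0 * exp (4 * R * 1 * t)" for i
  proof (rule abs_le_exp_of_neighbour_growth[where N=N and f'=f' and T=T and Z="\<lambda>i. 0" and M="2 * R"])
    fix i :: "int \<times> bool" and r assume r: "r \<in> {0..T}"
    obtain n l where i: "i = (n, l)" by (cases i)
    have "(a n has_real_derivative a n r / 2 * (b (n + 1) r - b n r)) (at r within {0..})"
      "(b n has_real_derivative (a n r)\<^sup>2 - (a (n - 1) r)\<^sup>2) (at r within {0..})"
      "(a' n has_real_derivative a' n r / 2 * (b' (n + 1) r - b' n r)) (at r within {0..})"
      "(b' n has_real_derivative (a' n r)\<^sup>2 - (a' (n - 1) r)\<^sup>2) (at r within {0..})"
      using toda r by (auto simp: toda_upto_def)
    then show "(f i has_real_derivative f' i r) (at r within {0..})"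
      by (cases l) (simp_all add: i f_def f'_def DERIV_diff)
    show "\<bar>f i r\<bar> \<le> 2 * R" using bd(1)[OF r, of n] bd(2)[OF r, of n] by (auto simp: i f_def)
    fix B assume B: "\<And>j. j \<in> N i \<Longrightarrow> \<bar>f j r\<bar> \<le> B"
    have xb: "\<bar>a k r - a' k r\<bar> \<le> B" "\<bar>b k r - b' k r\<bar> \<le> B" if "k \<in> {n - 1, n, n + 1}" for k
      using B[of "(k, True)"] B[of "(k, False)"] that by (auto simp: i N_def f_def)
    have "\<bar>(a n r - a' n r) * ((b (n + 1) r - b n r) / 2)\<bar> \<le> B * R"
      using bd(1)[OF r, of n] bd(1)[OF r, of "n + 1"] xb(1)[of n] by (intro abs_mult_le) auto
    moreover have "\<bar>a' n r / 2 * (b k r - b' k r)\<bar> \<le> R / 2 * B" if "k \<in> {n - 1, n, n + 1}" for k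
      using bd(2)[OF r, of n] by (intro abs_mult_le xb that) auto
    from this[of n] this[of "n + 1"]
    have "\<bar>a' n r / 2 * (b n r - b' n r)\<bar> \<le> R / 2 * B"
      "\<bar>a' n r / 2 * (b (n + 1) r - b' (n + 1) r)\<bar> \<le> R / 2 * B" by simp_all
    moreover have "a n r / 2 * (b (n + 1) r - b n r) - a' n r / 2 * (b' (n + 1) r - b' n r) =
       (a n r - a' n r) * ((b (n + 1) r - b n r) / 2) + a' n r / 2 * (b (n + 1) r - b' (n + 1) r)
        - a' n r / 2 * (b n r - b' n r)" by (simp add: field_simps)
    moreover have "B * R \<ge> 0" using xb(2)[of n] R by (intro mult_nonneg_nonneg) auto
    ultimately have 1: "\<bar>a n r / 2 * (b (n + 1) r - b n r) - a' n r / 2 * (b' (n + 1) r - b' n r)\<bar> \<le> 4 * (B * R)"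
      using mult.commute[of B R] by linarith
    have sq: "\<bar>(a k r - a' k r) * (a k r + a' k r)\<bar> \<le> B * (2 * R)" if "k \<in> {n - 1, n, n + 1}" for k
      using bd(1)[OF r, of k] bd(2)[OF r, of k] by (intro abs_mult_le xb that) auto
    have sqs: "\<bar>(a n r - a' n r) * (a n r + a' n r)\<bar> \<le> B * (2 * R)"
      "\<bar>(a (n - 1) r - a' (n - 1) r) * (a (n - 1) r + a' (n - 1) r)\<bar> \<le> B * (2 * R)" by (rule sq; simp)+
    have eq: "((a n r)\<^sup>2 - (a (n - 1) r)\<^sup>2) - ((a' n r)\<^sup>2 - (a' (n - 1) r)\<^sup>2) =
        (a n r - a' n r) * (a n r + a' n r) - (a (n - 1) r - a' (n - 1) r) * (a (n - 1) r + a' (n - 1) r)"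
      by (simp add: power2_eq_square algebra_simps)
    have 2: "\<bar>((a n r)\<^sup>2 - (a (n - 1) r)\<^sup>2) - ((a' n r)\<^sup>2 - (a' (n - 1) r)\<^sup>2)\<bar> \<le> 4 * (B * R)"
      unfolding eq using sqs by linarith
    show "\<bar>f' i r\<bar> \<le> 4 * R * B" using 1 2 by (cases l) (simp_all add: i f'_def mult_ac)
  next
    fix i :: "int \<times> bool" show "\<bar>f i 0\<bar> \<le> 0" by (auto simp: f_def init split: prod.splits)
  qed (use t R in auto)
  from this[of "(n, True)"] this[of "(n, False)"]
  show "a n t = a' n t" "b n t = b' n t"
    by (simp_all add: f_def)
qed

section \<open>Slowly varying majorants\<close>

lemma summable_on_geometric_int:
  assumes "0 \<le> x" "x < (1::real)"
  shows "(\<lambda>k::int. x ^ nat \<bar>k\<bar>) summable_on UNIV"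
proof -
  have geo: "(\<lambda>n::nat. x ^ n) summable_on UNIV"
    using assms by (intro norm_summable_imp_summable_on) (simp add: norm_power summable_geometric)
  have geo': "(\<lambda>n::nat. x ^ Suc n) summable_on UNIV"
    using summable_on_cmult_right[OF geo, of x] by simp
  have "(\<lambda>k::int. x ^ nat \<bar>k\<bar>) summable_on {0..}"
    by (subst summable_on_reindex_bij_witness[where i=int and j=nat and T=UNIV and h="\<lambda>n. x ^ n"])
      (auto intro: geo)
  moreover have "(\<lambda>k::int. x ^ nat \<bar>k\<bar>) summable_on {..<0}"
    by (subst summable_on_reindex_bij_witness[where i="\<lambda>n. - int (Suc n)" and j="\<lambda>k. nat (- k - 1)"
          and T=UNIV and h="\<lambda>n. x ^ Suc n"])
      (use geo' in \<open>auto simp flip: power_Suc simp: Suc_nat_eq_nat_zadd1\<close>)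
  ultimately have "(\<lambda>k::int. x ^ nat \<bar>k\<bar>) summable_on ({0..} \<union> {..<0})"
    by (rule summable_on_Un_disjoint) auto
  moreover have "{0..} \<union> {..<0} = (UNIV :: int set)" by auto
  ultimately show ?thesis by simp
qed

lemma slowly_varying_power:
  fixes w :: "int \<Rightarrow> real"
  assumes up: "\<And>n. w (n + 1) \<le> 2 * w n" and down: "\<And>n. w n \<le> 2 * w (n + 1)"
  shows "w (n + k) \<le> 2 ^ nat \<bar>k\<bar> * w n"
proof -
  have u: "w (n + int j) \<le> 2 ^ j * w n" for j n
  proof (induction j)
    case (Suc j)
    then show ?case using up[of "n + int j"] by (simp add: algebra_simps)
  qed simp
  have d: "w (n - int j) \<le> 2 ^ j * w n" for j n
  proof (induction j)
    case (Suc j)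
    then show ?case using down[of "n - int (Suc j)"] by (simp add: algebra_simps)
  qed simp
  show ?thesis using u[of n "nat k"] d[of n "nat (- k)"] by (cases "k \<ge> 0") (auto simp: abs_if)
qed

text \<open>The convolution of \<open>y\<close> with \<open>4^(-\<bar>k\<bar>)\<close> dominates \<open>y\<close> and varies by at most the factor \<open>4\<close> between
neighbours. The weighted sum stays finite because the weight grows at most like \<open>2^\<bar>k\<bar>\<close>, which the
kernel beats: the convolution costs only the factor \<open>\<Sum> 2^(-\<bar>k\<bar>)\<close>.\<close>
lemma slowly_varying_majorant:
  fixes y w :: "int \<Rightarrow> real"
  assumes y: "\<And>n. y n \<ge> 0" and w: "\<And>n. w n > 0"
    and up: "\<And>n. w (n + 1) \<le> 2 * w n" and down: "\<And>n. w n \<le> 2 * w (n + 1)"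
    and sum: "(\<lambda>n. w n * y n) summable_on UNIV"
  obtains Z where "\<And>n. y n \<le> Z n" "\<And>n. Z (n + 1) \<le> 4 * Z n" "\<And>n. Z n \<le> 4 * Z (n + 1)"
    and "(\<lambda>n. w n * Z n) summable_on UNIV"
proof -
  define g where "g n m = w n * ((1/4) ^ nat \<bar>n - m\<bar> * y m)" for n m
  obtain S where S: "((\<lambda>k::int. (1/2::real) ^ nat \<bar>k\<bar>) has_sum S) UNIV"
    using summable_on_geometric_int[of "1/2"] by (auto simp: summable_on_def)
  \<comment> \<open>In the coordinates \<open>m\<close> and \<open>k = n - m\<close> the double series is dominated by a product of two convergent series.\<close>
  have "(\<lambda>(m, k). (w m * y m) * (1/2) ^ nat \<bar>k\<bar>) summable_on UNIV \<times> (UNIV :: int set)"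
  proof (rule summable_on_SigmaI)
    show "((\<lambda>k::int. case (m, k) of (m, k) \<Rightarrow> (w m * y m) * (1/2) ^ nat \<bar>k\<bar>) has_sum (w m * y m * S)) UNIV" for m
      unfolding prod.case by (rule has_sum_cmult_right[OF S])
    show "(\<lambda>m. w m * y m * S) summable_on UNIV" by (rule summable_on_cmult_left[OF sum])
  qed (use y w in \<open>auto simp: less_imp_le\<close>)
  then have "(\<lambda>(m, k). g (m + k) m) summable_on UNIV \<times> (UNIV :: int set)"
  proof (rule summable_on_comparison_test)
    fix x :: "int \<times> int"
    obtain m k where x: "x = (m, k)" by (cases x)
    have "g (m + k) m \<le> (2 ^ nat \<bar>k\<bar> * w m) * ((1/4) ^ nat \<bar>k\<bar> * y m)"
      unfolding g_def using slowly_varying_power[of w, OF up down, of m k] y by (simp add: mult_right_mono)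
    also have "\<dots> = (w m * y m) * (2 * (1/4)) ^ nat \<bar>k\<bar>"
      by (simp only: power_mult_distrib mult_ac)
    finally show "(case x of (m, k) \<Rightarrow> g (m + k) m) \<le> (case x of (m, k) \<Rightarrow> (w m * y m) * (1/2) ^ nat \<bar>k\<bar>)"
      by (simp add: x)
    show "0 \<le> (case x of (m, k) \<Rightarrow> g (m + k) m)"
      using y w by (simp add: x g_def less_imp_le)
  qed
  also have "?this \<longleftrightarrow> (\<lambda>(n, m). g n m) summable_on UNIV \<times> UNIV"
    by (rule summable_on_reindex_bij_witness[where j="\<lambda>(m, k). (m + k, m)" and i="\<lambda>(n, m). (m, n - m)"]) auto
  finally have g: "(\<lambda>(n, m). g n m) summable_on UNIV \<times> UNIV" .
  have row: "(\<lambda>m. (1/4) ^ nat \<bar>n - m\<bar> * y m) summable_on UNIV" for n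
  proof -
    have "g n summable_on UNIV" by (rule summable_on_SigmaD1[OF g]) simp
    from summable_on_cmult_right[OF this, of "1 / w n"] show ?thesis
      using w[of n] by (simp add: g_def[abs_def])
  qed
  define Z where "Z n = (\<Sum>\<^sub>\<infinity>m. (1/4) ^ nat \<bar>n - m\<bar> * y m)" for n
  have slow: "Z n \<le> 4 * Z n'" if "\<bar>n - n'\<bar> \<le> 1" for n n'
  proof -
    have "Z n \<le> (\<Sum>\<^sub>\<infinity>m. 4 * ((1/4) ^ nat \<bar>n' - m\<bar> * y m))"
      unfolding Z_def
    proof (rule infsum_mono[OF row summable_on_cmult_right[OF row]])
      fix m
      have "(1/4::real) ^ Suc (nat \<bar>n - m\<bar>) \<le> (1/4) ^ nat \<bar>n' - m\<bar>"
        using that by (intro power_decreasing) auto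
      then have "(1/4) ^ nat \<bar>n - m\<bar> \<le> 4 * (1/4::real) ^ nat \<bar>n' - m\<bar>" by simp
      from mult_right_mono[OF this y[of m]]
      show "(1/4) ^ nat \<bar>n - m\<bar> * y m \<le> 4 * ((1/4) ^ nat \<bar>n' - m\<bar> * y m)" by simp
    qed
    then show ?thesis by (simp add: infsum_cmult_right' Z_def)
  qed
  show thesis
  proof
    show "y n \<le> Z n" for n
      using finite_sum_le_infsum[OF row[of n], of "{n}"] y by (simp add: Z_def)
    show "Z (n + 1) \<le> 4 * Z n" "Z n \<le> 4 * Z (n + 1)" for n by (auto intro!: slow)
    have "(\<lambda>n. infsum (g n) UNIV) summable_on UNIV"
      by (rule summable_on_Sigma_banach[OF g])
    then show "(\<lambda>n. w n * Z n) summable_on UNIV"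
      by (simp add: g_def[abs_def] infsum_cmult_right' Z_def)
  qed
qed

section \<open>The Cauchy problem in the given class\<close>

lemma abs_bounded_of_summable_left_tendsto_right:
  fixes y :: "int \<Rightarrow> real"
  assumes left: "(\<lambda>n. real_of_int \<bar>n\<bar> * y n) summable_on {..<0}" and right: "(y \<longlongrightarrow> l) at_top"
    and y: "\<And>n. y n \<ge> 0"
  obtains C where "\<And>n. y n \<le> C"
proof -
  let ?S = "infsum (\<lambda>n. real_of_int \<bar>n\<bar> * y n) {..<0}"
  have neg: "y n \<le> ?S" if "n < 0" for n
  proof -
    have "1 * y n \<le> real_of_int \<bar>n\<bar> * y n" using that y by (intro mult_right_mono) auto
    also have "\<dots> = (\<Sum>n\<in>{n}. real_of_int \<bar>n\<bar> * y n)" by simp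
    also have "\<dots> \<le> ?S"
      by (rule finite_sum_le_infsum[OF left _ _ mult_nonneg_nonneg]) (use that y in auto)
    finally show ?thesis by simp
  qed
  obtain N where N: "\<And>n. n \<ge> N \<Longrightarrow> y n < l + 1"
    using order_tendstoD(2)[OF right, of "l + 1"] by (auto simp: eventually_at_top_linorder)
  define M where "M = Max (insert ?S (insert (l + 1) (y ` {0..N})))"
  have M: "?S \<le> M" "l + 1 \<le> M" "\<And>n. n \<in> {0..N} \<Longrightarrow> y n \<le> M"
    unfolding M_def by (auto simp del: Max_insert intro!: Max_ge)
  have "y n \<le> M" for n
  proof -
    consider "n < 0" | "n \<ge> N" | "n \<in> {0..N}" by fastforce
    then show ?thesis
    proof cases
      case 1
      then show ?thesis using neg[of n] M(1) by linarith
    next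
      case 2
      then show ?thesis using N[of n] M(2) by linarith
    next
      case 3
      then show ?thesis by (rule M(3))
    qed
  qed
  then show thesis by (rule that)
qed

lemma C_norm_tendsto_0:
  assumes g: "(g \<longlongrightarrow> 0) at_top" and f: "\<And>(n::int) t. t \<in> {0..T} \<Longrightarrow> \<bar>f n t\<bar> \<le> g n"
  shows "((\<lambda>n. C_norm T (\<lambda>t. ennreal \<bar>f n t\<bar>)) \<longlongrightarrow> 0) at_top"
proof (rule tendsto_sandwich[where f="\<lambda>_. 0" and h="\<lambda>n. ennreal (g n)"])
  show "((\<lambda>n. ennreal (g n)) \<longlongrightarrow> 0) at_top"
    using tendsto_ennrealI[OF g] by simp
  show "\<forall>\<^sub>F n in at_top. C_norm T (\<lambda>t. ennreal \<bar>f n t\<bar>) \<le> ennreal (g n)"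
    unfolding C_norm_def by (intro always_eventually allI SUP_least ennreal_leI f)
qed auto

lemma toda_Q_le:
  assumes "(\<lambda>n. real_of_int \<bar>n\<bar> * z n) summable_on {..<0}"
    and "\<And>n. n < 0 \<Longrightarrow> \<bar>a n t - 1\<bar> + \<bar>b n t\<bar> \<le> z n"
  shows "toda_Q a b t \<le> ennreal (infsum (\<lambda>n. real_of_int \<bar>n\<bar> * z n) {..<0})"
  unfolding toda_Q_def nonneg_infsum_complete[OF zero_le]
proof (rule SUP_least)
  fix F :: "int set" assume "F \<in> {F. finite F \<and> F \<subseteq> {..<0}}"
  then have F: "finite F" "F \<subseteq> {..<0}" by auto
  have z: "z n \<ge> 0" if "n < 0" for n using assms(2)[OF that] by linarith
  have "(\<Sum>n\<in>F. ennreal (real_of_int \<bar>n\<bar> * (\<bar>a n t - 1\<bar> + \<bar>b n t\<bar>)))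
      = ennreal (\<Sum>n\<in>F. real_of_int \<bar>n\<bar> * (\<bar>a n t - 1\<bar> + \<bar>b n t\<bar>))"
    by (rule sum_ennreal) auto
  also have "\<dots> \<le> ennreal (infsum (\<lambda>n. real_of_int \<bar>n\<bar> * z n) {..<0})"
  proof (rule ennreal_leI)
    have "(\<Sum>n\<in>F. real_of_int \<bar>n\<bar> * (\<bar>a n t - 1\<bar> + \<bar>b n t\<bar>)) \<le> (\<Sum>n\<in>F. real_of_int \<bar>n\<bar> * z n)"
      using F by (intro sum_mono mult_left_mono assms(2)) auto
    also have "\<dots> \<le> infsum (\<lambda>n. real_of_int \<bar>n\<bar> * z n) {..<0}"
      by (rule finite_sum_le_infsum[OF assms(1) _ _ mult_nonneg_nonneg]) (use F z in auto)
    finally show "(\<Sum>n\<in>F. real_of_int \<bar>n\<bar> * (\<bar>a n t - 1\<bar> + \<bar>b n t\<bar>))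
        \<le> infsum (\<lambda>n. real_of_int \<bar>n\<bar> * z n) {..<0}" .
  qed
  finally show "(\<Sum>n\<in>F. ennreal (real_of_int \<bar>n\<bar> * (\<bar>a n t - 1\<bar> + \<bar>b n t\<bar>)))
      \<le> ennreal (infsum (\<lambda>n. real_of_int \<bar>n\<bar> * z n) {..<0})" .
qed

text \<open>Membership in the class bounds a solution on \<open>[0,T]\<close> uniformly in \<open>n\<close>: large \<open>n\<close> by the decay
condition, negative \<open>n\<close> by single terms of \<open>Q\<close>, and the finitely many remaining \<open>n\<close> by continuity.\<close>
lemma toda_cauchy_solution_bounded:
  assumes sol: "toda_cauchy_solution a0 b0 a b" and T: "T > 0"
  obtains R where "\<And>n t. t \<in> {0..T} \<Longrightarrow> \<bar>a n t\<bar> \<le> R \<and> \<bar>b n t\<bar> \<le> R"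
proof -
  have sol: "toda_solution a b" and cls: "toda_class a b"
    using assms(1) by (auto simp: toda_cauchy_solution_def)
  have right: "\<exists>N. \<forall>n\<ge>N. \<forall>t\<in>{0..T}. \<bar>f n t\<bar> \<le> 1"
    if lim: "((\<lambda>n. C_norm T (\<lambda>t. ennreal \<bar>f n t\<bar>)) \<longlongrightarrow> 0) at_top" for f :: "int \<Rightarrow> real \<Rightarrow> real"
  proof -
    obtain N where N: "\<And>n. n \<ge> N \<Longrightarrow> C_norm T (\<lambda>t. ennreal \<bar>f n t\<bar>) < 1"
      using order_tendstoD(2)[OF lim, of 1] by (auto simp: eventually_at_top_linorder)
    have "\<bar>f n t\<bar> \<le> 1" if "n \<ge> N" "t \<in> {0..T}" for n t
    proof -
      have "ennreal \<bar>f n t\<bar> \<le> C_norm T (\<lambda>t. ennreal \<bar>f n t\<bar>)"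
        unfolding C_norm_def by (rule SUP_upper[OF that(2)])
      also have "\<dots> < 1" by (rule N[OF that(1)])
      finally show ?thesis by (simp add: ennreal_less_one_iff less_imp_le)
    qed
    then show ?thesis by blast
  qed
  obtain N1 where N1: "\<And>n t. n \<ge> N1 \<Longrightarrow> t \<in> {0..T} \<Longrightarrow> \<bar>a n t\<bar> \<le> 1"
    using right[of a] cls T unfolding toda_class_def by blast
  obtain N2 where N2: "\<And>n t. n \<ge> N2 \<Longrightarrow> t \<in> {0..T} \<Longrightarrow> \<bar>b n t\<bar> \<le> 1"
    using right[of b] cls T unfolding toda_class_def by blast
  define N where "N = max N1 N2"
  obtain q where q: "C_norm T (toda_Q a b) = ennreal q" "q \<ge> 0"
    using cls T unfolding toda_class_def by (metis ennreal_cases infinity_ennreal_def less_irrefl)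
  have left: "\<bar>a n t - 1\<bar> + \<bar>b n t\<bar> \<le> q" if n: "n < 0" and t: "t \<in> {0..T}" for n t
  proof -
    let ?x = "\<lambda>n. \<bar>a n t - 1\<bar> + \<bar>b n t\<bar>"
    have "1 * ?x n \<le> real_of_int \<bar>n\<bar> * ?x n" using n by (intro mult_right_mono) auto
    then have "ennreal (?x n) \<le> ennreal (real_of_int \<bar>n\<bar> * ?x n)"
      unfolding mult_1 by (rule ennreal_leI)
    also have "\<dots> = (\<Sum>n\<in>{n}. ennreal (real_of_int \<bar>n\<bar> * ?x n))" by simp
    also have "\<dots> \<le> toda_Q a b t"
      unfolding toda_Q_def nonneg_infsum_complete[OF zero_le] using n by (intro SUP_upper) auto
    also have "\<dots> \<le> C_norm T (toda_Q a b)" unfolding C_norm_def by (rule SUP_upper[OF t])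
    finally show ?thesis by (simp only: q(1) ennreal_le_iff[OF q(2)])
  qed
  have mid: "\<exists>B. \<forall>t\<in>{0..T}. \<bar>a n t\<bar> \<le> B \<and> \<bar>b n t\<bar> \<le> B" for n
  proof -
    have der: "(a n has_real_derivative a n t / 2 * (b (n + 1) t - b n t)) (at t within {0..T})"
      "(b n has_real_derivative (a n t)\<^sup>2 - (a (n - 1) t)\<^sup>2) (at t within {0..T})" if "t \<in> {0..T}" for t
      using sol that by (auto simp: toda_solution_def intro!: has_field_derivative_subset[of _ _ _ "{0..}" "{0..T}"])
    have "continuous_on {0..T} (a n)" by (rule DERIV_continuous_on) (rule der(1))
    moreover have "continuous_on {0..T} (b n)" by (rule DERIV_continuous_on) (rule der(2))
    ultimately have "bounded (a n ` {0..T})" "bounded (b n ` {0..T})"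
      by (auto intro!: compact_imp_bounded compact_continuous_image)
    then obtain B1 B2 where "\<And>t. t \<in> {0..T} \<Longrightarrow> \<bar>a n t\<bar> \<le> B1" "\<And>t. t \<in> {0..T} \<Longrightarrow> \<bar>b n t\<bar> \<le> B2"
      unfolding bounded_iff real_norm_def by blast
    then show ?thesis by (intro exI[of _ "max B1 B2"]) (auto simp: le_max_iff_disj)
  qed
  have "\<forall>n. \<exists>B. \<forall>t\<in>{0..T}. \<bar>a n t\<bar> \<le> B \<and> \<bar>b n t\<bar> \<le> B" using mid by simp
  from choice[OF this] obtain B where B: "\<And>n t. t \<in> {0..T} \<Longrightarrow> \<bar>a n t\<bar> \<le> B n \<and> \<bar>b n t\<bar> \<le> B n" by blast
  define R where "R = Max (insert 1 (insert (q + 1) (B ` {0..N})))"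
  have R: "1 \<le> R" "q + 1 \<le> R" "\<And>n. n \<in> {0..N} \<Longrightarrow> B n \<le> R"
    unfolding R_def by (auto simp del: Max_insert intro!: Max_ge)
  have "\<bar>a n t\<bar> \<le> R \<and> \<bar>b n t\<bar> \<le> R" if t: "t \<in> {0..T}" for n t
  proof -
    consider "n < 0" | "n \<ge> N" | "n \<in> {0..N}" by fastforce
    then show ?thesis
    proof cases
      case 1
      then show ?thesis using left[OF 1 t] R(2) q(2) by linarith
    next
      case 2
      then show ?thesis using N1[of n t] N2[of n t] t R(1) by (simp add: N_def)
    next
      case 3
      then show ?thesis using B[OF t, of n] R(3)[OF 3] by linarith
    qed
  qed
  then show thesis by (rule that)
qed

lemma toda_solution_upto: "toda_solution a b \<Longrightarrow> toda_upto T a b"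
  unfolding toda_solution_def toda_upto_def by simp

lemma toda_cauchy_solution_unique:
  assumes "toda_cauchy_solution a0 b0 a b" "toda_cauchy_solution a0 b0 a' b'" and t: "t \<ge> 0"
  shows "a n t = a' n t \<and> b n t = b' n t"
proof -
  have T: "t + 1 > 0" using t by simp
  obtain R1 where R1: "\<And>n s. s \<in> {0..t + 1} \<Longrightarrow> \<bar>a n s\<bar> \<le> R1 \<and> \<bar>b n s\<bar> \<le> R1"
    using toda_cauchy_solution_bounded[OF assms(1) T] by blast
  obtain R2 where R2: "\<And>n s. s \<in> {0..t + 1} \<Longrightarrow> \<bar>a' n s\<bar> \<le> R2 \<and> \<bar>b' n s\<bar> \<le> R2"
    using toda_cauchy_solution_bounded[OF assms(2) T] by blast
  let ?R = "max R1 R2"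
  have bd: "\<And>n s. s \<in> {0..t + 1} \<Longrightarrow> \<bar>a n s\<bar> \<le> ?R \<and> \<bar>b n s\<bar> \<le> ?R"
    "\<And>n s. s \<in> {0..t + 1} \<Longrightarrow> \<bar>a' n s\<bar> \<le> ?R \<and> \<bar>b' n s\<bar> \<le> ?R"
    using R1 R2 by (simp_all add: le_max_iff_disj)
  have toda: "toda_upto (t + 1) a b" "toda_upto (t + 1) a' b'"
    using assms by (auto simp: toda_cauchy_solution_def intro: toda_solution_upto)
  have init: "a n 0 = a' n 0" "b n 0 = b' n 0" for n
    using assms by (auto simp: toda_cauchy_solution_def)
  show ?thesis
    using toda_bounded_solutions_unique[OF toda bd init, of t n] t by simp
qed

text \<open>The solution is the bounded one; it remains to see that it belongs to the class. For the condition on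
\<open>Q\<close>, the initial deviation \<open>y\<close> is replaced by a slowly varying majorant \<open>Z\<close> which is still summable
with weight \<open>\<bar>n\<bar>\<close> on the left and which the flow propagates.\<close>
lemma toda_cauchy_solution_exists:
  fixes a0 b0 :: "int \<Rightarrow> real"
  assumes pos: "\<And>n. a0 n > 0" and a0: "(a0 \<longlongrightarrow> 0) at_top" and b0: "(b0 \<longlongrightarrow> 0) at_top"
    and left: "(\<lambda>n. real_of_int \<bar>n\<bar> * (\<bar>a0 n - 1\<bar> + \<bar>b0 n\<bar>)) summable_on {..<0}"
  shows "\<exists>a b. toda_cauchy_solution a0 b0 a b"
proof -
  define y where "y n = \<bar>a0 n - 1\<bar> + \<bar>b0 n\<bar>" for n
  have y0: "y n \<ge> 0" for n by (simp add: y_def)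
  have "(y \<longlongrightarrow> \<bar>0 - 1\<bar> + \<bar>0\<bar>) at_top" unfolding y_def by (intro tendsto_intros a0 b0)
  then obtain C where C: "\<And>n. y n \<le> C"
    using abs_bounded_of_summable_left_tendsto_right[of y] left y0 by (auto simp: y_def)
  have "\<bar>a0 n\<bar> \<le> C + 1" "\<bar>b0 n\<bar> \<le> C + 1" for n using C[of n] by (auto simp: y_def)
  then obtain a b :: "int \<Rightarrow> real \<Rightarrow> real" and R where init: "\<And>n. a n 0 = a0 n" "\<And>n. b n 0 = b0 n"
    and toda: "\<And>T. toda_upto T a b"
    and bd: "\<And>n t. t \<ge> 0 \<Longrightarrow> \<bar>a n t\<bar> \<le> R" "\<And>n t. t \<ge> 0 \<Longrightarrow> \<bar>b n t\<bar> \<le> R"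
    using toda_bounded_solution_exists[of a0 "C + 1" b0] by blast
  have der: "(a n has_real_derivative a n t / 2 * (b (n + 1) t - b n t)) (at t within {0..})"
    "(b n has_real_derivative (a n t)\<^sup>2 - (a (n - 1) t)\<^sup>2) (at t within {0..})" if "t \<ge> 0" for n t
    using toda[of t] that by (auto simp: toda_upto_def)
  have pos': "a n t > 0" if t: "t \<ge> 0" for n t
  proof (rule linear_ode_positive[where f="a n" and t=t and g="\<lambda>s. (b (n + 1) s - b n s) / 2" and K=R])
    fix s assume "s \<in> {0..t}"
    then have s: "s \<ge> 0" by simp
    show "(a n has_real_derivative a n s * ((b (n + 1) s - b n s) / 2)) (at s within {0..})"
      using der(1)[OF s, of n] by simp
    show "\<bar>(b (n + 1) s - b n s) / 2\<bar> \<le> R" using bd(2)[OF s, of n] bd(2)[OF s, of "n + 1"] by auto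
  qed (use t pos init in auto)
  have sol: "toda_solution a b" unfolding toda_solution_def using der pos' by blast

  \<comment> \<open>On the right \<open>y\<close> is merely bounded, as \<open>a0\<close> tends to \<open>0\<close> and not to \<open>1\<close>; the weight is continued there by a summable sequence.\<close>
  define w :: "int \<Rightarrow> real" where "w n = (if n < 0 then real_of_int \<bar>n\<bar> else (1/2) ^ nat \<bar>n\<bar>)" for n
  have w0: "w n > 0" for n by (simp add: w_def)
  have w: "w (n + 1) \<le> 2 * w n \<and> w n \<le> 2 * w (n + 1)" for n
  proof -
    consider "n \<ge> 0" | "n = -1" | "n < -1" by linarith
    then show ?thesis
    proof cases
      case 1
      then have "nat \<bar>n + 1\<bar> = Suc (nat \<bar>n\<bar>)" by simp
      then show ?thesis using 1 by (simp add: w_def)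
    qed (auto simp: w_def)
  qed
  have "(\<lambda>n. w n * y n) summable_on {..<0}"
    using left by (rule summable_on_cong[THEN iffD1, rotated]) (auto simp: w_def y_def)
  moreover have "(\<lambda>n. w n * y n) summable_on {0..}"
  proof (rule summable_on_comparison_test)
    show "(\<lambda>n::int. (1/2) ^ nat \<bar>n\<bar> * C) summable_on {0..}"
      by (rule summable_on_subset_banach[OF summable_on_cmult_left[OF summable_on_geometric_int]]) auto
  qed (use C y0 w0 in \<open>auto simp: w_def less_imp_le intro!: mult_left_mono\<close>)
  ultimately have "(\<lambda>n. w n * y n) summable_on ({..<0} \<union> {0..})"
    by (rule summable_on_Un_disjoint) auto
  moreover have "{..<0} \<union> {0..} = (UNIV :: int set)" by auto
  ultimately have "(\<lambda>n. w n * y n) summable_on UNIV" by simp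
  then obtain Z where Z: "\<And>n. y n \<le> Z n" and slow: "\<And>n. Z (n + 1) \<le> 4 * Z n" "\<And>n. Z n \<le> 4 * Z (n + 1)"
    and sumZ: "(\<lambda>n. w n * Z n) summable_on UNIV"
    using slowly_varying_majorant[of y w] y0 w0 w by blast
  have Z0: "\<bar>a n 0 - 1\<bar> \<le> Z n" "\<bar>b n 0\<bar> \<le> Z n" for n
    using Z[of n] by (auto simp: y_def init)
  have sumZ': "(\<lambda>n. real_of_int \<bar>n\<bar> * (c * Z n)) summable_on {..<0}" for c
  proof -
    have "(\<lambda>n. c * (w n * Z n)) summable_on {..<0}"
      by (rule summable_on_subset_banach[OF summable_on_cmult_right[OF sumZ]]) auto
    then show ?thesis by (rule summable_on_cong[THEN iffD1, rotated]) (auto simp: w_def)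
  qed

  have "toda_class a b" unfolding toda_class_def
  proof (intro allI impI conjI)
    fix T :: real assume T: "T > 0"
    have bdT: "\<And>n t. t \<in> {0..T} \<Longrightarrow> \<bar>a n t\<bar> \<le> R" "\<And>n t. t \<in> {0..T} \<Longrightarrow> \<bar>b n t\<bar> \<le> R"
      using bd by auto
    have R: "R \<ge> 0" using bd(1)[of 0 0] by simp
    have a0': "((\<lambda>n. a0 (n - 1)) \<longlongrightarrow> 0) at_top"
      by (rule filterlim_compose[OF a0]) (auto simp: filterlim_at_top intro: eventually_at_top_linorderI[of "_ + 1"])
    have "((\<lambda>n. \<bar>a0 n\<bar> * exp (R * T)) \<longlongrightarrow> \<bar>0\<bar> * exp (R * T)) at_top"
      by (intro tendsto_intros a0)
    then show "((\<lambda>n. C_norm T (\<lambda>t. ennreal \<bar>a n t\<bar>)) \<longlongrightarrow> 0) at_top"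
      by (intro C_norm_tendsto_0[where g="\<lambda>n. \<bar>a0 n\<bar> * exp (R * T)"])
        (use toda_right_bound(1)[OF toda bdT] init in auto)
    have "((\<lambda>n. \<bar>b0 n\<bar> + ((\<bar>a0 n\<bar> * exp (R * T))\<^sup>2 + (\<bar>a0 (n - 1)\<bar> * exp (R * T))\<^sup>2) * T)
        \<longlongrightarrow> \<bar>0\<bar> + ((\<bar>0\<bar> * exp (R * T))\<^sup>2 + (\<bar>0\<bar> * exp (R * T))\<^sup>2) * T) at_top"
      by (intro tendsto_intros a0 a0' b0)
    then show "((\<lambda>n. C_norm T (\<lambda>t. ennreal \<bar>b n t\<bar>)) \<longlongrightarrow> 0) at_top"
      by (intro C_norm_tendsto_0[where g="\<lambda>n. \<bar>b0 n\<bar> + ((\<bar>a0 n\<bar> * exp (R * T))\<^sup>2 + (\<bar>a0 (n - 1)\<bar> * exp (R * T))\<^sup>2) * T"])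
        (use toda_right_bound(2)[OF toda bdT] init in auto)
    define E where "E = 2 * exp (2 * (R + 1) * 4 * T)"
    have "toda_Q a b t \<le> ennreal (infsum (\<lambda>n. real_of_int \<bar>n\<bar> * (E * Z n)) {..<0})" if t: "t \<in> {0..T}" for t
    proof (rule toda_Q_le[OF sumZ'])
      fix n :: int
      have "exp (2 * (R + 1) * 4 * t) \<le> exp (2 * (R + 1) * 4 * T)"
        using t R by (auto intro!: mult_left_mono)
      then have "Z n * exp (2 * (R + 1) * 4 * t) \<le> Z n * exp (2 * (R + 1) * 4 * T)"
        using Z[of n] y0[of n] by (intro mult_left_mono) auto
      moreover have "E * Z n = 2 * (Z n * exp (2 * (R + 1) * 4 * T))" by (simp add: E_def)
      moreover have "(1::real) \<le> 4" by simp
      note toda_left_bound[OF toda bdT Z0 slow this t, of n]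
      ultimately show "\<bar>a n t - 1\<bar> + \<bar>b n t\<bar> \<le> E * Z n" by linarith
    qed
    then have "C_norm T (toda_Q a b) \<le> ennreal (infsum (\<lambda>n. real_of_int \<bar>n\<bar> * (E * Z n)) {..<0})"
      unfolding C_norm_def by (rule SUP_least)
    then show "C_norm T (toda_Q a b) < \<infinity>"
      by (rule order_le_less_trans) simp
  qed
  with sol init show ?thesis unfolding toda_cauchy_solution_def by blast
qed

theorem theorem2:
  fixes a0 b0 :: "int \<Rightarrow> real"
  assumes "\<And>n. a0 n > 0"
    and "(a0 \<longlongrightarrow> 0) at_top"
    and "(b0 \<longlongrightarrow> 0) at_top"
    and "(\<lambda>n. real_of_int \<bar>n\<bar> * (\<bar>a0 n - 1\<bar> + \<bar>b0 n\<bar>)) summable_on {..<0}"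
  shows "(\<exists>a b. toda_cauchy_solution a0 b0 a b) \<and>
         (\<forall>a b a' b'. toda_cauchy_solution a0 b0 a b \<and> toda_cauchy_solution a0 b0 a' b' \<longrightarrow>
            (\<forall>n. \<forall>t\<ge>0. a n t = a' n t \<and> b n t = b' n t))"
proof (intro conjI allI impI)
  show "\<exists>a b. toda_cauchy_solution a0 b0 a b"
    using assms by (rule toda_cauchy_solution_exists)
next
  fix a b a' b' n and t :: real
  assume "toda_cauchy_solution a0 b0 a b \<and> toda_cauchy_solution a0 b0 a' b'" and "t \<ge> 0"
  then show "a n t = a' n t" "b n t = b' n t"
    using toda_cauchy_solution_unique by blast+
qed

end
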